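(* Let $E_1,\dots,E_m$ and $F$ be Banach spaces. If each $E_i$ has the Schur property and the projective tensor product $E_1\hat{\otimes}_{\pi}\cdots\hat{\otimes}_{\pi}E_m$ also has the Schur property, then $\mathcal{DP}\circ\mathcal{L}(E_1,\dots,E_m;F)=\mathcal{L}_{WDP}^{\mathrm{ev}}(E_1,\dots,E_m;F)$.
   Context: Banach spaces are over $\mathbb{K}=\mathbb{R}$ or $\mathbb{C}$; $F'$ is the topological dual of $F$; $\overset{w}{\to}$ denotes weak convergence of sequences (in $F'$ this means $\sigma(F',F'')$); $\mathcal{L}(E_1,\dots,E_m;F)$ is the space of continuous $m$-linear operators; $E_1\hat{\otimes}_{\pi}\cdots\hat{\otimes}_{\pi}E_m$ is the completed projective tensor product. A Banach space has the Schur property if every weakly convergent sequence in it converges in norm. A bounded linear operator $u\colon G\to F$ is Dunford–Pettis, $u\in\mathcal{DP}(G;F)$, if $x_j\overset{w}{\to}0$ in $G$ implies $\|u(x_j)\|\to0$. $\mathcal{DP}\circ\mathcal{L}(E_1,\dots,E_m;F)$ is the set of all $T\in\mathcal{L}(E_1,\dots,E_m;F)$ of the form $T=u\circ S$ with $G$ a Banach space, $S\in\mathcal{L}(E_1,\dots,E_m;G)$ and $u\in\mathcal{DP}(G;F)$. $T\in\mathcal{L}_{WDP}^{\mathrm{ev}}(E_1,\dots,E_m;F)$ if $T\in\mathcal{L}(E_1,\dots,E_m;F)$ and for all $(a_1,\dots,a_m)\in E_1\times\cdots\times E_m$, all sequences $x_j^{(i)}\overset{w}{\to}a_i$ in $E_i$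 ($i=1,\dots,m$), and all sequences $f_j\overset{w}{\to}f$ in $F'$ with $f\in F'$, one has $f_j(T(x_j^{(1)},\dots,x_j^{(m)}))\to f(T(a_1,\dots,a_m))$. *)

theory Defs
  imports
    "HOL-Analysis.Analysis"
    "HOL-Library.Poly_Mapping"
    "HOL-Library.Set_Algebras"
    "HOL-Algebra.Module"
begin

section \<open>Normed and Banach spaces with explicit carriers\<close>

text \<open>
  The spaces $E_1,\dots,E_m$ have to be different spaces, so a normed space is a module record
  of HOL-Algebra with a norm, rather than a type of class \<open>real_normed_vector\<close>.
  The scalars are a type of class \<open>real_normed_field\<close>; by the theorem of Gelfand and Mazur the
  fields of this class are, up to isometric isomorphism, exactly the real and the complex numbers.

  The \<open>module\<close> record inherits the fields \<open>mult\<close> and \<open>one\<close> from \<open>ring\<close>; the locale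
  \<open>module\<close> says nothing about them and they play no role here.
\<close>

record ('k, 'v) nspace = "('k, 'v) Module.module" +
  vnorm :: "'v \<Rightarrow> real"

definition scalars :: "'k::real_normed_field ring" where
  "scalars = \<lparr>carrier = UNIV, mult = (*), one = 1, zero = 0, add = (+)\<rparr>"

locale normed_space = Module.module scalars V
  for V :: "('k::real_normed_field, 'v) nspace" (structure) +
  assumes vnorm_nonneg: "x \<in> carrier V \<Longrightarrow> 0 \<le> vnorm V x"
    and vnorm_eq_0: "x \<in> carrier V \<Longrightarrow> vnorm V x = 0 \<longleftrightarrow> x = \<zero>\<^bsub>V\<^esub>"
    and vnorm_smult: "x \<in> carrier V \<Longrightarrow> vnorm V (t \<odot>\<^bsub>V\<^esub> x) = norm t * vnorm V x"
    and vnorm_triangle: "\<lbrakk>x \<in> carrier V; y \<in> carrier V\<rbrakk> \<Longrightarrow> vnorm V (x \<oplus>\<^bsub>V\<^esub> y) \<le> vnorm V x + vnorm V y"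

definition norm_conv :: "('k, 'v) nspace \<Rightarrow> (nat \<Rightarrow> 'v) \<Rightarrow> 'v \<Rightarrow> bool" where
  "norm_conv V s a \<longleftrightarrow> range s \<subseteq> carrier V \<and> a \<in> carrier V \<and> (\<lambda>n. vnorm V (s n \<ominus>\<^bsub>V\<^esub> a)) \<longlonglongrightarrow> 0"

definition cauchy_seqs :: "('k, 'v) nspace \<Rightarrow> (nat \<Rightarrow> 'v) set" where
  "cauchy_seqs V = {s. range s \<subseteq> carrier V \<and>
     (\<forall>e>0. \<exists>N. \<forall>m\<ge>N. \<forall>n\<ge>N. vnorm V (s m \<ominus>\<^bsub>V\<^esub> s n) < e)}"

locale banach_space = normed_space +
  assumes complete: "s \<in> cauchy_seqs V \<Longrightarrow> \<exists>a. norm_conv V s a"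

text \<open>
  The locale \<open>Metric_space\<close> requires nonnegativity and symmetry of the distance also for
  arguments outside the carrier, hence the conditional.
\<close>

definition vdist :: "('k, 'v) nspace \<Rightarrow> 'v \<Rightarrow> 'v \<Rightarrow> real" where
  "vdist V x y = (if x \<in> carrier V \<and> y \<in> carrier V then vnorm V (x \<ominus>\<^bsub>V\<^esub> y) else 0)"

definition norm_topology :: "('k, 'v) nspace \<Rightarrow> 'v topology" where
  "norm_topology V = Metric_space.mtopology (carrier V) (vdist V)"

section \<open>Linear operators, duals, weak convergence\<close>

text \<open>
  Operators are undefined outside the carrier of their domain (\<open>extensional\<close>), so that
  equality of operators is equality of functions.
\<close>

definition linear_ops :: "('k, 'v) nspace \<Rightarrow> ('k, 'w) nspace \<Rightarrow> ('v \<Rightarrow> 'w) set" where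
  "linear_ops V W = {u \<in> carrier V \<rightarrow>\<^sub>E carrier W.
     (\<forall>x\<in>carrier V. \<forall>y\<in>carrier V. u (x \<oplus>\<^bsub>V\<^esub> y) = u x \<oplus>\<^bsub>W\<^esub> u y) \<and>
     (\<forall>t. \<forall>x\<in>carrier V. u (t \<odot>\<^bsub>V\<^esub> x) = t \<odot>\<^bsub>W\<^esub> u x)}"

definition scalar_space :: "('k::real_normed_field, 'k) nspace" where
  "scalar_space = \<lparr>carrier = UNIV, mult = (*), one = 1, zero = 0, add = (+), smult = (*), vnorm = norm\<rparr>"

definition dual :: "('k::real_normed_field, 'v) nspace \<Rightarrow> ('k, 'v \<Rightarrow> 'k) nspace" where
  "dual V = \<lparr>
     carrier = {f \<in> linear_ops V scalar_space. continuous_map (norm_topology V) (norm_topology scalar_space) f},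
     mult = undefined, one = undefined,
     zero = (\<lambda>x\<in>carrier V. 0),
     add = (\<lambda>f g. \<lambda>x\<in>carrier V. f x + g x),
     smult = (\<lambda>t f. \<lambda>x\<in>carrier V. t * f x),
     vnorm = (\<lambda>f. SUP x\<in>{x \<in> carrier V. vnorm V x \<le> 1}. norm (f x))\<rparr>"

definition weak_conv :: "('k::real_normed_field, 'v) nspace \<Rightarrow> (nat \<Rightarrow> 'v) \<Rightarrow> 'v \<Rightarrow> bool" where
  "weak_conv V s a \<longleftrightarrow> range s \<subseteq> carrier V \<and> a \<in> carrier V \<and>
     (\<forall>f\<in>carrier (dual V). (\<lambda>n. f (s n)) \<longlonglongrightarrow> f a)"

definition schur_property :: "('k::real_normed_field, 'v) nspace \<Rightarrow> bool" where
  "schur_property V \<longleftrightarrow> (\<forall>s a. weak_conv V s a \<longrightarrow> norm_conv V s a)"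

definition DP :: "('k::real_normed_field, 'v) nspace \<Rightarrow> ('k, 'w) nspace \<Rightarrow> ('v \<Rightarrow> 'w) set" where
  "DP G F = {u \<in> linear_ops G F.
     (\<exists>C. \<forall>x\<in>carrier G. vnorm F (u x) \<le> C * vnorm G x) \<and>
     (\<forall>s. weak_conv G s \<zero>\<^bsub>G\<^esub> \<longrightarrow> (\<lambda>n. vnorm F (u (s n))) \<longlonglongrightarrow> 0)}"

section \<open>Multilinear operators\<close>

text \<open>
  A finite family $E_1,\dots,E_m$, $m \ge 1$, is indexed by a type \<open>'i::finite\<close> with $m$ elements.
  All carriers are sets over one type \<open>'e\<close>, which is no restriction: the carriers of
  finitely many spaces can be placed in a sum type.
\<close>

definition tuples :: "('i::finite \<Rightarrow> ('k, 'e) nspace) \<Rightarrow> ('i \<Rightarrow> 'e) set" where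
  "tuples E = (\<Pi>\<^sub>E i\<in>UNIV. carrier (E i))"

definition multilinear_ops ::
    "('i::finite \<Rightarrow> ('k::real_normed_field, 'e) nspace) \<Rightarrow> ('k, 'f) nspace \<Rightarrow> (('i \<Rightarrow> 'e) \<Rightarrow> 'f) set" where
  "multilinear_ops E F = {T \<in> tuples E \<rightarrow>\<^sub>E carrier F.
     (\<forall>x\<in>tuples E. \<forall>i. (\<lambda>a\<in>carrier (E i). T (x(i := a))) \<in> linear_ops (E i) F) \<and>
     continuous_map (product_topology (\<lambda>i. norm_topology (E i)) UNIV) (norm_topology F) T}"

text \<open>
  HOL cannot quantify over types inside a formula. The intermediate space \<open>G\<close> therefore ranges
  over the Banach spaces whose carrier is a set over a type \<open>'g\<close>, which is a parameter.
  Replacing \<open>G\<close> by the closed linear span of the range of \<open>S\<close> shows that the choice of \<open>'g\<close> is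
  irrelevant as soon as there are as many elements of \<open>'g\<close> as sequences of finite linear
  combinations of tuples. In particular the types \<open>('i, 'e, 'k) ptensor + 'h\<close>, with
  \<open>ptensor\<close> from the end of this theory and \<open>'h\<close> arbitrary, are large enough; with
  \<open>'h\<close> the carrier type of a given Banach space, that space is among the admitted ones.
\<close>

definition DP_comp_L ::
    "'g itself \<Rightarrow> ('i::finite \<Rightarrow> ('k::real_normed_field, 'e) nspace) \<Rightarrow> ('k, 'f) nspace \<Rightarrow> (('i \<Rightarrow> 'e) \<Rightarrow> 'f) set" where
  "DP_comp_L _ E F = {T \<in> multilinear_ops E F.
     \<exists>(G :: ('k, 'g) nspace) S u. banach_space G \<and> S \<in> multilinear_ops E G \<and> u \<in> DP G F \<and>
       T = compose (tuples E) u S}"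

definition L_WDP_ev ::
    "('i::finite \<Rightarrow> ('k::real_normed_field, 'e) nspace) \<Rightarrow> ('k, 'f) nspace \<Rightarrow> (('i \<Rightarrow> 'e) \<Rightarrow> 'f) set" where
  "L_WDP_ev E F = {T \<in> multilinear_ops E F.
     \<forall>a\<in>tuples E. \<forall>x :: 'i \<Rightarrow> nat \<Rightarrow> 'e. (\<forall>i. weak_conv (E i) (x i) (a i)) \<longrightarrow>
       (\<forall>\<phi> f. weak_conv (dual F) \<phi> f \<longrightarrow> (\<lambda>j. \<phi> j (T (\<lambda>i. x i j))) \<longlonglongrightarrow> f (T a))}"

section \<open>The completed projective tensor product\<close>

text \<open>
  The algebraic tensor product is the free vector space on the tuples modulo the span of the
  multilinearity relations. The free vector space consists of the finitely supported functions
  on tuples; \<open>Poly_Mapping.single x 1\<close> is the basis vector of the tuple \<open>x\<close>.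
\<close>

definition fscale :: "'k::real_normed_field \<Rightarrow> ('x \<Rightarrow>\<^sub>0 'k) \<Rightarrow> ('x \<Rightarrow>\<^sub>0 'k)" where
  "fscale t = Poly_Mapping.map (\<lambda>c. t * c)"

definition tensor_relations ::
    "('i::finite \<Rightarrow> ('k::real_normed_field, 'e) nspace) \<Rightarrow> (('i \<Rightarrow> 'e) \<Rightarrow>\<^sub>0 'k) set" where
  "tensor_relations E = Modules.module.span fscale
    ({Poly_Mapping.single (x(i := a \<oplus>\<^bsub>E i\<^esub> b)) 1 - Poly_Mapping.single (x(i := a)) 1
        - Poly_Mapping.single (x(i := b)) 1 | x i a b.
        x \<in> tuples E \<and> a \<in> carrier (E i) \<and> b \<in> carrier (E i)} \<union>
     {Poly_Mapping.single (x(i := t \<odot>\<^bsub>E i\<^esub> a)) 1 - fscale t (Poly_Mapping.single (x(i := a)) 1) | x i t a.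
        x \<in> tuples E \<and> a \<in> carrier (E i)})"

text \<open>
  An element \<open>z\<close> of the algebraic tensor product is a coset; its elements are the representations
  $z = \sum_j \lambda_j\, x^{(1)}_j \otimes \dots \otimes x^{(m)}_j$, and the norm is
  $\pi(z) = \inf \sum_j |\lambda_j|\, \|x^{(1)}_j\| \cdots \|x^{(m)}_j\|$ over these.
\<close>

definition alg_tensor ::
    "('i::finite \<Rightarrow> ('k::real_normed_field, 'e) nspace) \<Rightarrow> ('k, (('i \<Rightarrow> 'e) \<Rightarrow>\<^sub>0 'k) set) nspace" where
  "alg_tensor E = \<lparr>
     carrier = {c +o tensor_relations E | c. Poly_Mapping.keys c \<subseteq> tuples E},
     mult = undefined, one = undefined,
     zero = tensor_relations E,
     add = (\<lambda>A B. A + B),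
     smult = (\<lambda>t A. fscale t ` A + tensor_relations E),
     vnorm = (\<lambda>A. INF c\<in>{c \<in> A. Poly_Mapping.keys c \<subseteq> tuples E}.
        \<Sum>x\<in>Poly_Mapping.keys c. norm (Poly_Mapping.lookup c x) * (\<Prod>i\<in>UNIV. vnorm (E i) (x i)))\<rparr>"

definition null_rel :: "('k, 'v) nspace \<Rightarrow> ((nat \<Rightarrow> 'v) \<times> (nat \<Rightarrow> 'v)) set" where
  "null_rel V = {(s, s'). s \<in> cauchy_seqs V \<and> s' \<in> cauchy_seqs V \<and>
     (\<lambda>n. vnorm V (s n \<ominus>\<^bsub>V\<^esub> s' n)) \<longlonglongrightarrow> 0}"

definition completion :: "('k, 'v) nspace \<Rightarrow> ('k, (nat \<Rightarrow> 'v) set) nspace" where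
  "completion V = \<lparr>
     carrier = cauchy_seqs V // null_rel V,
     mult = undefined, one = undefined,
     zero = null_rel V `` {\<lambda>n. \<zero>\<^bsub>V\<^esub>},
     add = (\<lambda>A B. \<Union>s\<in>A. \<Union>s'\<in>B. null_rel V `` {\<lambda>n. s n \<oplus>\<^bsub>V\<^esub> s' n}),
     smult = (\<lambda>t A. \<Union>s\<in>A. null_rel V `` {\<lambda>n. t \<odot>\<^bsub>V\<^esub> s n}),
     vnorm = (\<lambda>A. THE r. \<forall>s\<in>A. (\<lambda>n. vnorm V (s n)) \<longlonglongrightarrow> r)\<rparr>"

type_synonym ('i, 'e, 'k) ptensor = "(nat \<Rightarrow> (('i \<Rightarrow> 'e) \<Rightarrow>\<^sub>0 'k) set) set"

definition proj_tensor ::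
    "('i::finite \<Rightarrow> ('k::real_normed_field, 'e) nspace) \<Rightarrow> ('k, ('i, 'e, 'k) ptensor) nspace" where
  "proj_tensor E = completion (alg_tensor E)"

end

theory Submission
  imports Defs
begin

text \<open>
  Every continuous multilinear operator lies in both classes. For the evaluation class, the Schur property of
  the factors turns weak convergence into norm convergence, which a continuous operator preserves; weakly
  convergent functionals converge pointwise and are bounded by the uniform boundedness principle, so they
  may be evaluated along norm convergent sequences. For the composition class, an operator factors through
  the projective tensor product, and every bounded linear operator on a space with the Schur property
  is Dunford--Pettis.

  The algebraic tensor product is only treated as a seminormed space: its completion identifies sequences
  at distance zero anyway, so no Hahn--Banach argument is needed to see that the projective seminorm is a norm.
\<close>

section \<open>Seminormed spaces\<close>

text \<open>The definitions speak of continuity while the estimates need constants, so linear and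
  multilinear operators are first characterised by bounds. From continuity to a bound, arguments are
  scaled into a small ball; from a bound to continuity in several variables, coordinates are
  exchanged one at a time. The tensor product has three layers (finitely supported sums, cosets,
  classes of Cauchy sequences), and an operator is carried through them in that order. One constant
  serves for all three, because an inequality between bounds survives both the infimum over
  representations and the limit along a Cauchy sequence. A second obstacle is typing:
  \<open>DP_comp_L\<close> prescribes the type that carries the intermediate space. The
  factorization therefore runs through an isometric copy of the tensor product, and weakly null
  sequences are brought back to the original by the inverse isometry before the Schur property is
  applied.\<close>

lemma scalars_simps [simp]:
  "carrier scalars = UNIV" "mult scalars = (*)" "one scalars = 1" "zero scalars = 0" "add scalars = (+)"
  by (simp_all add: scalars_def)

lemma cring_scalars: "cring (scalars :: 'k::real_normed_field ring)"
proof (rule cringI)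
  show "abelian_group (scalars :: 'k ring)"
  proof (rule abelian_groupI)
    fix x :: 'k assume "x \<in> carrier scalars"
    show "\<exists>y\<in>carrier scalars. y \<oplus>\<^bsub>scalars\<^esub> x = \<zero>\<^bsub>scalars\<^esub>"
      by (rule bexI[of _ "- x"]) auto
  qed (auto simp: algebra_simps)
  show "Group.comm_monoid (scalars :: 'k ring)"
    by (rule comm_monoidI) (auto simp: algebra_simps)
qed (auto simp: algebra_simps)

text \<open>No additive inverse has to be supplied: \<open>(- 1) \<odot> x\<close> is one, since the
  scalars \<open>- 1\<close> and \<open>1\<close> add up to \<open>0\<close> and
  \<open>0 \<odot> x\<close> is the zero vector. The constructions below thus need only their
  primitive operations.\<close>

lemma module_scalarsI:
  fixes V :: "('k::real_normed_field, 'v, 'z) module_scheme" (structure)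
  assumes "\<zero> \<in> carrier V"
    and add: "\<And>x y. x \<in> carrier V \<Longrightarrow> y \<in> carrier V \<Longrightarrow> x \<oplus> y \<in> carrier V"
    and smult: "\<And>t x. x \<in> carrier V \<Longrightarrow> t \<odot> x \<in> carrier V"
    and "\<And>x y z. x \<in> carrier V \<Longrightarrow> y \<in> carrier V \<Longrightarrow> z \<in> carrier V \<Longrightarrow> x \<oplus> y \<oplus> z = x \<oplus> (y \<oplus> z)"
    and "\<And>x y. x \<in> carrier V \<Longrightarrow> y \<in> carrier V \<Longrightarrow> x \<oplus> y = y \<oplus> x"
    and "\<And>x. x \<in> carrier V \<Longrightarrow> \<zero> \<oplus> x = x"
    and zero: "\<And>x. x \<in> carrier V \<Longrightarrow> 0 \<odot> x = \<zero>"
    and one: "\<And>x. x \<in> carrier V \<Longrightarrow> 1 \<odot> x = x"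
    and distr: "\<And>s t x. x \<in> carrier V \<Longrightarrow> (s + t) \<odot> x = s \<odot> x \<oplus> t \<odot> x"
    and "\<And>t x y. x \<in> carrier V \<Longrightarrow> y \<in> carrier V \<Longrightarrow> t \<odot> (x \<oplus> y) = t \<odot> x \<oplus> t \<odot> y"
    and "\<And>s t x. x \<in> carrier V \<Longrightarrow> (s * t) \<odot> x = s \<odot> (t \<odot> x)"
  shows "Module.module scalars V"
proof (rule moduleI)
  show "abelian_group V"
  proof (rule abelian_groupI)
    fix x assume x: "x \<in> carrier V"
    have "(- 1) \<odot> x \<oplus> x = \<zero>"
      using distr[of x "- 1" 1] x by (simp add: zero one)
    then show "\<exists>y\<in>carrier V. y \<oplus> x = \<zero>" using smult x by blast
  qed (use assms in auto)
qed (use assms cring_scalars in auto)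

locale seminormed_space = Module.module scalars V
  for V :: "('k::real_normed_field, 'v) nspace" (structure) +
  assumes seminorm_nonneg: "x \<in> carrier V \<Longrightarrow> 0 \<le> vnorm V x"
    and seminorm_smult: "x \<in> carrier V \<Longrightarrow> vnorm V (t \<odot> x) = norm t * vnorm V x"
    and seminorm_triangle: "\<lbrakk>x \<in> carrier V; y \<in> carrier V\<rbrakk> \<Longrightarrow> vnorm V (x \<oplus> y) \<le> vnorm V x + vnorm V y"
begin

lemma scale_closed [simp, intro]: "x \<in> carrier V \<Longrightarrow> t \<odot> x \<in> carrier V"
  by (rule smult_closed) simp_all

lemma scale_zero [simp]: "x \<in> carrier V \<Longrightarrow> 0 \<odot> x = \<zero>"
  using smult_l_null by simp

lemma scale_zero_right [simp]: "t \<odot> \<zero> = \<zero>"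
  using smult_r_null by simp

lemma scale_one [simp]: "x \<in> carrier V \<Longrightarrow> 1 \<odot> x = x"
  using smult_one by simp

lemma scale_add_left: "x \<in> carrier V \<Longrightarrow> (s + t) \<odot> x = s \<odot> x \<oplus> t \<odot> x"
  using smult_l_distr by simp

lemma scale_add_right: "x \<in> carrier V \<Longrightarrow> y \<in> carrier V \<Longrightarrow> t \<odot> (x \<oplus> y) = t \<odot> x \<oplus> t \<odot> y"
  using smult_r_distr by simp

lemma scale_scale: "x \<in> carrier V \<Longrightarrow> s \<odot> (t \<odot> x) = (s * t) \<odot> x"
  using smult_assoc1 by simp

lemma minus_scale: "x \<in> carrier V \<Longrightarrow> \<ominus> x = (- 1) \<odot> x"
  using scale_add_left[of x "- 1" 1] by (simp add: M.minus_equality)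

text \<open>Subtraction is not a field of the record. Expressing it by addition and scaling reduces
  statements on differences to the two primitive operations, for linear maps as well as for
  completions and transported spaces.\<close>

lemma diff_scale: "x \<in> carrier V \<Longrightarrow> y \<in> carrier V \<Longrightarrow> x \<ominus> y = x \<oplus> (- 1) \<odot> y"
  by (simp add: M.minus_eq minus_scale)

lemma seminorm_zero [simp]: "vnorm V \<zero> = 0"
  using seminorm_smult[of \<zero> 0] by simp

lemma seminorm_minus: "x \<in> carrier V \<Longrightarrow> vnorm V (\<ominus> x) = vnorm V x"
  by (simp add: minus_scale seminorm_smult)

lemma diff_self [simp]: "x \<in> carrier V \<Longrightarrow> x \<ominus> x = \<zero>"
  by (simp add: M.minus_eq M.r_neg)

lemma diff_zero [simp]: "x \<in> carrier V \<Longrightarrow> x \<ominus> \<zero> = x"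
  by (simp add: M.minus_eq)

lemma add_diff_add:
  "\<lbrakk>x \<in> carrier V; y \<in> carrier V; z \<in> carrier V; w \<in> carrier V\<rbrakk> \<Longrightarrow> (x \<oplus> y) \<ominus> (z \<oplus> w) = (x \<ominus> z) \<oplus> (y \<ominus> w)"
  by (simp add: M.minus_eq M.minus_add M.a_ac)

lemma add_diff_cancel_left: "x \<in> carrier V \<Longrightarrow> y \<in> carrier V \<Longrightarrow> (x \<oplus> y) \<ominus> x = y"
  using add_diff_add[of x y x \<zero>] by simp

lemma diff_add_diff:
  "\<lbrakk>x \<in> carrier V; y \<in> carrier V; z \<in> carrier V\<rbrakk> \<Longrightarrow> (x \<ominus> y) \<oplus> (y \<ominus> z) = x \<ominus> z"
  by (simp add: M.minus_eq M.a_ac M.r_neg2 M.r_neg1)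

lemma add_diff_cancel: "x \<in> carrier V \<Longrightarrow> y \<in> carrier V \<Longrightarrow> (x \<ominus> y) \<oplus> y = x"
  by (simp add: M.minus_eq M.a_ac M.r_neg)

lemma diff_eq_zero_iff: "x \<in> carrier V \<Longrightarrow> y \<in> carrier V \<Longrightarrow> x \<ominus> y = \<zero> \<longleftrightarrow> x = y"
  using add_diff_cancel[of x y] by auto

lemma minus_diff: "x \<in> carrier V \<Longrightarrow> y \<in> carrier V \<Longrightarrow> \<ominus> (x \<ominus> y) = y \<ominus> x"
  by (simp add: M.minus_eq M.minus_add M.a_ac)

lemma scale_diff: "x \<in> carrier V \<Longrightarrow> y \<in> carrier V \<Longrightarrow> t \<odot> (x \<ominus> y) = t \<odot> x \<ominus> t \<odot> y"
  by (simp add: diff_scale scale_add_right scale_scale mult.commute)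

lemma seminorm_diff_commute: "x \<in> carrier V \<Longrightarrow> y \<in> carrier V \<Longrightarrow> vnorm V (x \<ominus> y) = vnorm V (y \<ominus> x)"
  by (metis minus_diff M.minus_closed seminorm_minus)

lemma seminorm_diff_triangle:
  "\<lbrakk>x \<in> carrier V; y \<in> carrier V; z \<in> carrier V\<rbrakk> \<Longrightarrow> vnorm V (x \<ominus> z) \<le> vnorm V (x \<ominus> y) + vnorm V (y \<ominus> z)"
  by (metis diff_add_diff M.minus_closed seminorm_triangle)

lemma seminorm_diff_ge:
  assumes "x \<in> carrier V" "y \<in> carrier V"
  shows "\<bar>vnorm V x - vnorm V y\<bar> \<le> vnorm V (x \<ominus> y)"
  using seminorm_diff_triangle[of x y \<zero>] seminorm_diff_triangle[of y x \<zero>]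
    seminorm_diff_commute[of x y] assms by auto

end

lemma (in normed_space) seminormed_space: "seminormed_space V"
  by unfold_locales (auto simp: vnorm_nonneg vnorm_smult vnorm_triangle)

sublocale normed_space \<subseteq> seminormed_space
  by (rule seminormed_space)

section \<open>The norm topology and metric completeness\<close>

context normed_space
begin

lemma metric: "Metric_space (carrier V) (vdist V)"
proof
  fix x y z
  show "0 \<le> vdist V x y" by (simp add: vdist_def vnorm_nonneg)
  show "vdist V x y = vdist V y x" by (simp add: vdist_def seminorm_diff_commute)
  show "x \<in> carrier V \<Longrightarrow> y \<in> carrier V \<Longrightarrow> (vdist V x y = 0) = (x = y)"
    by (simp add: vdist_def vnorm_eq_0 diff_eq_zero_iff)
  show "x \<in> carrier V \<Longrightarrow> y \<in> carrier V \<Longrightarrow> z \<in> carrier V \<Longrightarrow> vdist V x z \<le> vdist V x y + vdist V y z"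
    by (simp add: vdist_def seminorm_diff_triangle)
qed

sublocale metric: Metric_space "carrier V" "vdist V"
  by (rule metric)

lemma norm_topology_eq: "norm_topology V = metric.mtopology"
  by (simp add: norm_topology_def)

lemma topspace_norm_topology [simp]: "topspace (norm_topology V) = carrier V"
  by (simp add: norm_topology_eq)

lemma vdist_eq [simp]: "x \<in> carrier V \<Longrightarrow> y \<in> carrier V \<Longrightarrow> vdist V x y = vnorm V (x \<ominus> y)"
  by (simp add: vdist_def)

lemma norm_conv_iff_limitin:
  assumes "range s \<subseteq> carrier V"
  shows "norm_conv V s a \<longleftrightarrow> limitin (norm_topology V) s a sequentially"
proof -
  have s: "s n \<in> carrier V" for n using assms by auto
  show ?thesis
    using assms s by (auto simp: norm_conv_def norm_topology_eq metric.limitin_metric_dist_null)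
qed

lemma norm_conv_unique:
  assumes "norm_conv V s a" "norm_conv V s b"
  shows "a = b"
  using assms by (metis metric.limitin_metric_unique norm_conv_def norm_conv_iff_limitin norm_topology_eq sequentially_bot)

text \<open>Translates completeness of a \<open>banach_space\<close> into the form that the Baire
  category theorem asks for.\<close>

lemma mcomplete_iff: "metric.mcomplete \<longleftrightarrow> (\<forall>s\<in>cauchy_seqs V. \<exists>a. norm_conv V s a)"
proof -
  have "metric.MCauchy s \<longleftrightarrow> s \<in> cauchy_seqs V" for s
  proof (cases "range s \<subseteq> carrier V")
    case True
    then have "s n \<in> carrier V" for n by auto
    then show ?thesis using True by (auto simp: metric.MCauchy_def cauchy_seqs_def)
  qed (auto simp: metric.MCauchy_def cauchy_seqs_def)
  then show ?thesis
    unfolding metric.mcomplete_def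
    by (metis (no_types, lifting) cauchy_seqs_def mem_Collect_eq norm_conv_iff_limitin norm_topology_eq)
qed

end

section \<open>Linear operators and duals\<close>

lemma linear_opsI:
  assumes "u \<in> carrier V \<rightarrow>\<^sub>E carrier W"
    and "\<And>x y. x \<in> carrier V \<Longrightarrow> y \<in> carrier V \<Longrightarrow> u (x \<oplus>\<^bsub>V\<^esub> y) = u x \<oplus>\<^bsub>W\<^esub> u y"
    and "\<And>t x. x \<in> carrier V \<Longrightarrow> u (t \<odot>\<^bsub>V\<^esub> x) = t \<odot>\<^bsub>W\<^esub> u x"
  shows "u \<in> linear_ops V W"
  using assms by (simp add: linear_ops_def)

lemma
  assumes "u \<in> linear_ops V W"
  shows linear_ops_closed: "x \<in> carrier V \<Longrightarrow> u x \<in> carrier W"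
    and linear_ops_add: "x \<in> carrier V \<Longrightarrow> y \<in> carrier V \<Longrightarrow> u (x \<oplus>\<^bsub>V\<^esub> y) = u x \<oplus>\<^bsub>W\<^esub> u y"
    and linear_ops_smult: "x \<in> carrier V \<Longrightarrow> u (t \<odot>\<^bsub>V\<^esub> x) = t \<odot>\<^bsub>W\<^esub> u x"
  using assms by (auto simp: linear_ops_def)

lemma
  assumes "seminormed_space V" "seminormed_space W" and u: "u \<in> linear_ops V W"
  shows linear_ops_zero: "u \<zero>\<^bsub>V\<^esub> = \<zero>\<^bsub>W\<^esub>"
    and linear_ops_diff: "x \<in> carrier V \<Longrightarrow> y \<in> carrier V \<Longrightarrow> u (x \<ominus>\<^bsub>V\<^esub> y) = u x \<ominus>\<^bsub>W\<^esub> u y"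
proof -
  interpret V: seminormed_space V by fact
  interpret W: seminormed_space W by fact
  note [simp] = linear_ops_closed[OF u] linear_ops_add[OF u] linear_ops_smult[OF u]
  show "u \<zero>\<^bsub>V\<^esub> = \<zero>\<^bsub>W\<^esub>"
    using linear_ops_smult[OF u, of "\<zero>\<^bsub>V\<^esub>" 0] by simp
  show "u (x \<ominus>\<^bsub>V\<^esub> y) = u x \<ominus>\<^bsub>W\<^esub> u y" if "x \<in> carrier V" "y \<in> carrier V"
    using that by (simp add: V.diff_scale W.diff_scale)
qed

lemma (in normed_space) in_mball_zero:
  "x \<in> metric.mball \<zero> r \<longleftrightarrow> x \<in> carrier V \<and> vnorm V x < r"
  by (auto simp: metric.in_mball seminorm_diff_commute[of \<zero>])

text \<open>Continuity at zero gives a ball that is sent into the unit ball, and homogeneity turns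
  this into a global bound; conversely a bound on differences is a Lipschitz condition.\<close>

lemma linear_ops_continuous_iff:
  fixes V :: "('k::real_normed_field, 'v) nspace"
  assumes "normed_space V" "normed_space W" and u: "u \<in> linear_ops V W"
  shows "continuous_map (norm_topology V) (norm_topology W) u \<longleftrightarrow>
    (\<exists>C. \<forall>x\<in>carrier V. vnorm W (u x) \<le> C * vnorm V x)"
proof -
  interpret V: normed_space V by fact
  interpret W: normed_space W by fact
  note [simp] = linear_ops_closed[OF u]
  note lin = linear_ops_add[OF u] linear_ops_smult[OF u]
    linear_ops_zero[OF V.seminormed_space W.seminormed_space u]
    linear_ops_diff[OF V.seminormed_space W.seminormed_space u]
  note cont = W.metric.continuous_map_to_metric[of "norm_topology V" u]
  show ?thesis
  proof
    assume "continuous_map (norm_topology V) (norm_topology W) u"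
    then obtain U where U: "openin (norm_topology V) U" "\<zero>\<^bsub>V\<^esub> \<in> U"
        "\<And>y. y \<in> U \<Longrightarrow> u y \<in> W.metric.mball (u \<zero>\<^bsub>V\<^esub>) 1"
      using cont by (metis V.M.zero_closed V.topspace_norm_topology W.norm_topology_eq zero_less_one)
    then obtain r where r: "r > 0" "V.metric.mball \<zero>\<^bsub>V\<^esub> r \<subseteq> U"
      by (auto simp: V.norm_topology_eq V.metric.openin_mtopology)
    have "vnorm W (u x) \<le> (2 / r) * vnorm V x" if x: "x \<in> carrier V" for x
    proof (cases "vnorm V x = 0")
      case True
      then have "x = \<zero>\<^bsub>V\<^esub>" using x by (simp add: V.vnorm_eq_0)
      then show ?thesis by (simp add: lin)
    next
      case False
      then have pos: "vnorm V x > 0" using V.vnorm_nonneg[OF x] by simp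
      \<comment> \<open>The factor that brings \<open>x\<close> to norm \<open>r / 2\<close>,
        strictly inside the ball of radius \<open>r\<close>. It is a real number embedded in the
        abstract scalar field.\<close>
      define t :: 'k where "t = of_real (r / (2 * vnorm V x))"
      have t: "norm t = r / (2 * vnorm V x)" using pos r by (simp add: t_def norm_divide norm_mult)
      have "vnorm V (t \<odot>\<^bsub>V\<^esub> x) = r / 2" using x pos by (simp add: V.vnorm_smult t)
      then have "t \<odot>\<^bsub>V\<^esub> x \<in> U" using r x V.in_mball_zero[of "t \<odot>\<^bsub>V\<^esub> x" r] by auto
      then have "vnorm W (u (t \<odot>\<^bsub>V\<^esub> x)) < 1"
        using U(3) W.in_mball_zero by (simp add: lin)
      then have "r / (2 * vnorm V x) * vnorm W (u x) < 1"
        using x by (simp add: lin W.vnorm_smult t)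
      then show ?thesis using pos r(1) by (simp add: field_simps)
    qed
    then show "\<exists>C. \<forall>x\<in>carrier V. vnorm W (u x) \<le> C * vnorm V x" by blast
  next
    assume "\<exists>C. \<forall>x\<in>carrier V. vnorm W (u x) \<le> C * vnorm V x"
    then obtain C where C: "\<And>x. x \<in> carrier V \<Longrightarrow> vnorm W (u x) \<le> C * vnorm V x" by blast
    show "continuous_map (norm_topology V) (norm_topology W) u"
      unfolding W.norm_topology_eq cont
    proof (intro ballI allI impI)
      fix x e assume x: "x \<in> topspace (norm_topology V)" and e: "(e::real) > 0"
      then have [simp]: "x \<in> carrier V" by simp
      \<comment> \<open>\<open>C\<close> may be zero or negative; \<open>\<bar>C\<bar> + 1\<close>
        dominates it and can be divided by.\<close>
      have "u y \<in> W.metric.mball (u x) e" if "y \<in> V.metric.mball x (e / (\<bar>C\<bar> + 1))" for y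
      proof -
        have y [simp]: "y \<in> carrier V" and d: "vnorm V (x \<ominus>\<^bsub>V\<^esub> y) < e / (\<bar>C\<bar> + 1)"
          using that by auto
        have "vnorm W (u x \<ominus>\<^bsub>W\<^esub> u y) \<le> C * vnorm V (x \<ominus>\<^bsub>V\<^esub> y)"
          using C[of "x \<ominus>\<^bsub>V\<^esub> y"] by (simp add: lin)
        also have "\<dots> \<le> (\<bar>C\<bar> + 1) * vnorm V (x \<ominus>\<^bsub>V\<^esub> y)"
          by (intro mult_right_mono V.vnorm_nonneg) auto
        also have "\<dots> < e" using d by (simp add: field_simps)
        finally show ?thesis by simp
      qed
      moreover have "x \<in> V.metric.mball x (e / (\<bar>C\<bar> + 1))" using e by simp
      ultimately show "\<exists>U. openin (norm_topology V) U \<and> x \<in> U \<and> (\<forall>y\<in>U. u y \<in> W.metric.mball (u x) e)"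
        unfolding V.norm_topology_eq by blast
    qed
  qed
qed

section \<open>The scalar field and the dual as normed spaces\<close>

lemma scalar_space_simps [simp]:
  "carrier scalar_space = UNIV" "add scalar_space = (+)" "zero scalar_space = 0"
  "smult scalar_space = (*)" "vnorm scalar_space = norm"
  by (simp_all add: scalar_space_def)

lemma normed_space_scalar_space: "normed_space (scalar_space :: ('k::real_normed_field, 'k) nspace)"
proof (intro normed_space.intro normed_space_axioms.intro)
  show "Module.module scalars (scalar_space :: ('k, 'k) nspace)"
    by (rule module_scalarsI) (auto simp: algebra_simps)
qed (auto simp: norm_mult norm_triangle_ineq)

interpretation scalar_space: normed_space scalar_space
  by (rule normed_space_scalar_space)

lemma scalar_space_minus [simp]: "x \<ominus>\<^bsub>scalar_space\<^esub> y = x - y"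
  by (simp add: scalar_space.diff_scale)

lemma dual_simps [simp]:
  "zero (dual V) = (\<lambda>x\<in>carrier V. 0)"
  "add (dual V) = (\<lambda>f g. \<lambda>x\<in>carrier V. f x + g x)"
  "smult (dual V) = (\<lambda>t f. \<lambda>x\<in>carrier V. t * f x)"
  by (simp_all add: dual_def)

lemma (in normed_space) carrier_dual_iff:
  "f \<in> carrier (dual V) \<longleftrightarrow>
    f \<in> linear_ops V scalar_space \<and> (\<exists>C. \<forall>x\<in>carrier V. norm (f x) \<le> C * vnorm V x)"
  using linear_ops_continuous_iff[OF normed_space_axioms normed_space_scalar_space]
  by (auto simp: dual_def)

text \<open>A supremum of reals dominates its set only if that set is bounded above, so this comes
  before every estimate by the dual norm.\<close>

lemma (in normed_space) bdd_above_dual_norm: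
  assumes "f \<in> carrier (dual V)"
  shows "bdd_above ((\<lambda>x. norm (f x)) ` {x \<in> carrier V. vnorm V x \<le> 1})"
proof -
  obtain C where C: "\<And>x. x \<in> carrier V \<Longrightarrow> norm (f x) \<le> C * vnorm V x"
    using assms by (auto simp: carrier_dual_iff)
  show ?thesis
  proof (rule bdd_aboveI2)
    fix y assume y: "y \<in> {x \<in> carrier V. vnorm V x \<le> 1}"
    then have "norm (f y) \<le> \<bar>C\<bar> * vnorm V y"
      using C[of y] vnorm_nonneg[of y] by (smt (verit) mem_Collect_eq mult_right_mono)
    also have "\<dots> \<le> \<bar>C\<bar>" using y by (simp add: mult_left_le)
    finally show "norm (f y) \<le> \<bar>C\<bar>" .
  qed
qed

lemma (in normed_space) dual_norm_bound:
  assumes f: "f \<in> carrier (dual V)" and x: "x \<in> carrier V"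
  shows "norm (f x) \<le> vnorm (dual V) f * vnorm V x"
proof -
  obtain C where lin: "f \<in> linear_ops V scalar_space"
    and C: "\<And>x. x \<in> carrier V \<Longrightarrow> norm (f x) \<le> C * vnorm V x"
    using f by (auto simp: carrier_dual_iff)
  show ?thesis
  proof (cases "vnorm V x = 0")
    case True
    then show ?thesis using C[OF x] by simp
  next
    case False
    then have pos: "vnorm V x > 0" using vnorm_nonneg[OF x] by simp
    define t :: 'k where "t = of_real (1 / vnorm V x)"
    have t: "norm t = 1 / vnorm V x" using pos by (simp add: t_def norm_divide)
    have "norm (f (t \<odot> x)) \<le> vnorm (dual V) f"
      unfolding dual_def nspace.simps
      by (rule cSUP_upper[OF _ bdd_above_dual_norm[OF f]]) (use x pos in \<open>simp add: vnorm_smult t\<close>)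
    then show ?thesis using x pos
      by (simp add: linear_ops_smult[OF lin] norm_mult t field_simps)
  qed
qed

lemma (in normed_space) dual_norm_least:
  assumes "\<And>x. x \<in> carrier V \<Longrightarrow> norm (f x) \<le> C * vnorm V x" "0 \<le> C"
  shows "vnorm (dual V) f \<le> C"
  unfolding dual_def nspace.simps
proof (rule cSUP_least)
  show "{x \<in> carrier V. vnorm V x \<le> 1} \<noteq> {}"
    by (metis (mono_tags, lifting) M.zero_closed empty_iff mem_Collect_eq seminorm_zero zero_le_one)
  fix x assume "x \<in> {x \<in> carrier V. vnorm V x \<le> 1}"
  then show "norm (f x) \<le> C"
    using assms(1)[of x] assms(2) mult_left_le[of "vnorm V x" C] by auto
qed

lemma (in normed_space) dual_norm_nonneg:
  assumes f: "f \<in> carrier (dual V)"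
  shows "0 \<le> vnorm (dual V) f"
proof -
  have "norm (f \<zero>) \<le> vnorm (dual V) f"
    unfolding dual_def nspace.simps by (rule cSUP_upper[OF _ bdd_above_dual_norm[OF f]]) simp
  then show ?thesis using norm_ge_zero order_trans by blast
qed

lemma (in normed_space) normed_space_dual: "normed_space (dual V)"
proof (intro normed_space.intro normed_space_axioms.intro)
  have clos_add: "(\<lambda>x\<in>carrier V. f x + g x) \<in> carrier (dual V)"
    and norm_add: "vnorm (dual V) (\<lambda>x\<in>carrier V. f x + g x) \<le> vnorm (dual V) f + vnorm (dual V) g"
    if f: "f \<in> carrier (dual V)" and g: "g \<in> carrier (dual V)" for f g
  proof -
    have b: "norm (f x + g x) \<le> (vnorm (dual V) f + vnorm (dual V) g) * vnorm V x" if "x \<in> carrier V" for x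
      using norm_triangle_ineq[of "f x" "g x"] dual_norm_bound[OF f that] dual_norm_bound[OF g that]
      by (simp add: algebra_simps)
    have "f \<in> linear_ops V scalar_space" "g \<in> linear_ops V scalar_space"
      using f g by (auto simp: carrier_dual_iff)
    then have "(\<lambda>x\<in>carrier V. f x + g x) \<in> linear_ops V scalar_space"
      by (auto intro!: linear_opsI simp: linear_ops_add linear_ops_smult algebra_simps)
    then show "(\<lambda>x\<in>carrier V. f x + g x) \<in> carrier (dual V)"
      using b by (auto simp: carrier_dual_iff)
    show "vnorm (dual V) (\<lambda>x\<in>carrier V. f x + g x) \<le> vnorm (dual V) f + vnorm (dual V) g"
      by (rule dual_norm_least) (use b f g in \<open>auto simp: dual_norm_nonneg\<close>)
  qed
  have clos_smult: "(\<lambda>x\<in>carrier V. t * f x) \<in> carrier (dual V)"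
    and norm_smult: "vnorm (dual V) (\<lambda>x\<in>carrier V. t * f x) \<le> norm t * vnorm (dual V) f"
    if f: "f \<in> carrier (dual V)" for t f
  proof -
    have b: "norm (t * f x) \<le> (norm t * vnorm (dual V) f) * vnorm V x" if "x \<in> carrier V" for x
      using dual_norm_bound[OF f that] by (simp add: norm_mult mult.assoc mult_left_mono)
    have "f \<in> linear_ops V scalar_space"
      using f by (auto simp: carrier_dual_iff)
    then have "(\<lambda>x\<in>carrier V. t * f x) \<in> linear_ops V scalar_space"
      by (auto intro!: linear_opsI simp: linear_ops_add linear_ops_smult algebra_simps)
    then show "(\<lambda>x\<in>carrier V. t * f x) \<in> carrier (dual V)"
      using b by (auto simp: carrier_dual_iff)
    show "vnorm (dual V) (\<lambda>x\<in>carrier V. t * f x) \<le> norm t * vnorm (dual V) f"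
      by (rule dual_norm_least) (use b f in \<open>auto simp: dual_norm_nonneg\<close>)
  qed
  have zero: "(\<lambda>x\<in>carrier V. 0) \<in> carrier (dual V)"
    by (auto simp: carrier_dual_iff intro!: linear_opsI exI[of _ 0])
  \<comment> \<open>Identities in the dual are equalities of functions. Off the carrier both sides
    are \<open>undefined\<close>, which is what extensionality provides.\<close>
  have ext: "f \<in> extensional (carrier V)" if "f \<in> carrier (dual V)" for f
    using that by (auto simp: carrier_dual_iff linear_ops_def PiE_def)
  show "Module.module scalars (dual V)"
    by (rule module_scalarsI)
      (use zero clos_add clos_smult in \<open>auto simp: algebra_simps fun_eq_iff dest: extensional_arb[OF ext]\<close>)
  fix f assume f: "f \<in> carrier (dual V)"
  show "0 \<le> vnorm (dual V) f" by (rule dual_norm_nonneg[OF f])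
  show "vnorm (dual V) f = 0 \<longleftrightarrow> f = \<zero>\<^bsub>dual V\<^esub>"
  proof
    assume "vnorm (dual V) f = 0"
    then show "f = \<zero>\<^bsub>dual V\<^esub>"
      using dual_norm_bound[OF f] ext[OF f] by (force simp: restrict_def extensional_def fun_eq_iff)
  next
    assume "f = \<zero>\<^bsub>dual V\<^esub>"
    then have "vnorm (dual V) f \<le> 0" by (intro dual_norm_least) auto
    then show "vnorm (dual V) f = 0" using dual_norm_nonneg[OF f] by simp
  qed
  show "vnorm (dual V) (t \<odot>\<^bsub>dual V\<^esub> f) = norm t * vnorm (dual V) f" for t
  proof (rule antisym)
    show "vnorm (dual V) (t \<odot>\<^bsub>dual V\<^esub> f) \<le> norm t * vnorm (dual V) f"
      using norm_smult[OF f] by simp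
    show "norm t * vnorm (dual V) f \<le> vnorm (dual V) (t \<odot>\<^bsub>dual V\<^esub> f)"
    proof (cases "t = 0")
      case True
      then show ?thesis using dual_norm_nonneg[OF clos_smult[OF f, of t]] by simp
    next
      case False
      \<comment> \<open>The inequality already shown for scaling, applied to
        \<open>inverse t\<close> and the functional \<open>t * f\<close>, gives back
        \<open>f\<close> and hence the reverse inequality.\<close>
      have "vnorm (dual V) f \<le> norm (inverse t) * vnorm (dual V) (t \<odot>\<^bsub>dual V\<^esub> f)"
        using norm_smult[OF clos_smult[OF f, of t], of "inverse t"] False
        by (simp add: mult.assoc[symmetric] extensional_restrict[OF ext[OF f]] cong: restrict_cong)
      then show ?thesis using False by (simp add: norm_inverse norm_divide field_simps)
    qed
  qed
  show "vnorm (dual V) (f \<oplus>\<^bsub>dual V\<^esub> g) \<le> vnorm (dual V) f + vnorm (dual V) g"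
    if "g \<in> carrier (dual V)" for g using norm_add[OF f that] by simp
qed

text \<open>Weak convergence in the dual is tested against the bidual. Evaluations at points belong
  to it, so weakly convergent functionals converge pointwise.\<close>

lemma (in normed_space) evaluation_in_bidual:
  assumes x: "x \<in> carrier V"
  shows "(\<lambda>f\<in>carrier (dual V). f x) \<in> carrier (dual (dual V))"
proof -
  interpret D: normed_space "dual V" by (rule normed_space_dual)
  have "(\<lambda>f\<in>carrier (dual V). f x) \<in> linear_ops (dual V) scalar_space"
    using D.M.a_closed D.scale_closed by (intro linear_opsI) (auto simp: x)
  then show ?thesis using dual_norm_bound[OF _ x]
    by (auto simp: D.carrier_dual_iff mult.commute intro!: exI[of _ "vnorm V x"])
qed

lemma (in normed_space) weak_conv_dual_pointwise:
  assumes "weak_conv (dual V) \<phi> f" and x: "x \<in> carrier V"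
  shows "(\<lambda>n. \<phi> n x) \<longlonglongrightarrow> f x"
proof -
  have "\<And>n. \<phi> n \<in> carrier (dual V)" "f \<in> carrier (dual V)"
    using assms by (auto simp: weak_conv_def)
  moreover have "(\<lambda>n. (\<lambda>f\<in>carrier (dual V). f x) (\<phi> n)) \<longlonglongrightarrow> (\<lambda>f\<in>carrier (dual V). f x) f"
    using assms(1) evaluation_in_bidual[OF x] unfolding weak_conv_def by blast
  ultimately show ?thesis by simp
qed

section \<open>Uniform boundedness\<close>

context banach_space
begin

text \<open>Baire's theorem: the closed sets \<open>K N\<close> exhaust the space, so one of them
  contains a ball. On that ball all functionals are bounded by \<open>N\<close> at once; shifting it
  to the origin and scaling gives the common bound.\<close>

theorem uniform_boundedness:
  assumes dual: "\<And>n. \<phi> n \<in> carrier (dual V)"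
    and ptw: "\<And>x. x \<in> carrier V \<Longrightarrow> \<exists>B. \<forall>n. norm (\<phi> n x) \<le> B"
  shows "\<exists>B. \<forall>n. \<forall>x\<in>carrier V. norm (\<phi> n x) \<le> B * vnorm V x"
proof -
  have lin: "\<phi> n \<in> linear_ops V scalar_space" for n
    using dual[of n] by (simp add: carrier_dual_iff)
  note [simp] = linear_ops_add[OF lin] linear_ops_smult[OF lin]
    linear_ops_diff[OF seminormed_space scalar_space.seminormed_space lin]
  define K where "K N = {x \<in> carrier V. \<forall>n. norm (\<phi> n x) \<le> real N}" for N :: nat
  have closed: "closedin metric.mtopology (K N)" for N
    unfolding metric.closedin_metric
  proof (intro conjI allI impI)
    show "K N \<subseteq> carrier V" by (auto simp: K_def)
    fix x assume "x \<in> carrier V - K N"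
    then obtain n where x [simp]: "x \<in> carrier V" and n: "norm (\<phi> n x) > real N"
      by (auto simp: K_def not_le)
    \<comment> \<open>The dual norm may vanish; adding 1 allows division by
      \<open>C\<close>.\<close>
    define C where "C = vnorm (dual V) (\<phi> n) + 1"
    have C: "C > 0" using dual_norm_nonneg[OF dual, of n] by (simp add: C_def)
    have bound: "norm (\<phi> n z) \<le> C * vnorm V z" if "z \<in> carrier V" for z
      using dual_norm_bound[OF dual that, of n] vnorm_nonneg[OF that] by (simp add: C_def distrib_right)
    \<comment> \<open>Moving \<open>x\<close> by less than \<open>r\<close> changes the value of the
      functional by less than its excess over \<open>N\<close>, so the whole ball stays outside
      \<open>K N\<close>.\<close>
    define r where "r = (norm (\<phi> n x) - real N) / C"
    have "y \<notin> K N" if "y \<in> metric.mball x r" for y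
    proof -
      have y [simp]: "y \<in> carrier V" and d: "vnorm V (x \<ominus> y) < r" using that by auto
      have "norm (\<phi> n x) - norm (\<phi> n y) \<le> norm (\<phi> n (x \<ominus> y))"
        by (simp add: norm_triangle_ineq2)
      also have "\<dots> \<le> C * vnorm V (x \<ominus> y)" by (rule bound) simp
      also have "\<dots> < norm (\<phi> n x) - real N" using d C by (simp add: r_def field_simps)
      finally show ?thesis by (auto simp: K_def not_le)
    qed
    moreover have "r > 0" using n C by (simp add: r_def)
    ultimately show "\<exists>r>0. disjnt (K N) (metric.mball x r)" by (auto simp: disjnt_iff)
  qed
  have "\<Union> (range K) = carrier V"
  proof -
    have "\<exists>N. x \<in> K N" if x: "x \<in> carrier V" for x
    proof -
      obtain B where B: "\<And>n. norm (\<phi> n x) \<le> B" using ptw[OF x] by blast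
      have "norm (\<phi> n x) \<le> real (nat \<lceil>B\<rceil>)" for n using B[of n] by linarith
      then show ?thesis using x by (auto simp: K_def)
    qed
    then show ?thesis by (auto simp: K_def)
  qed
  then have "metric.mtopology interior_of \<Union> (range K) \<noteq> {}"
    by (metis M.zero_closed empty_iff interior_of_topspace metric.topspace_mtopology)
  moreover have "metric.mtopology interior_of \<Union> (range K) = {}" if "\<And>N. metric.mtopology interior_of K N = {}"
    by (rule metric.metric_Baire_category_alt) (use complete closed that in \<open>auto simp: mcomplete_iff\<close>)
  ultimately obtain N where "metric.mtopology interior_of K N \<noteq> {}" by blast
  then obtain a r where [simp]: "a \<in> carrier V" and r: "r > 0" and ball: "metric.mball a r \<subseteq> K N"
    by (auto simp: metric.in_interior_of_mball)
  \<comment> \<open>The points \<open>a\<close> and \<open>a + t x\<close> both lie in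
    \<open>K N\<close>, so \<open>t x\<close> has image of norm at most \<open>2 N\<close>. With
    \<open>norm t = r / (2 * vnorm V x)\<close> this gives the factor
    \<open>4 N / r\<close>.\<close>
  have "norm (\<phi> n x) \<le> (4 * real N / r) * vnorm V x" if x [simp]: "x \<in> carrier V" for n x
  proof (cases "vnorm V x = 0")
    case True
    then show ?thesis using dual_norm_bound[OF dual x, of n] by simp
  next
    case False
    then have pos: "vnorm V x > 0" using vnorm_nonneg[OF x] by simp
    define t :: 'b where "t = of_real (r / (2 * vnorm V x))"
    have t: "norm t = r / (2 * vnorm V x)" using pos r by (simp add: t_def norm_divide norm_mult)
    have "vnorm V (t \<odot> x) < r" using pos r by (simp add: vnorm_smult t)
    moreover have "a \<ominus> (a \<oplus> t \<odot> x) = \<ominus> (t \<odot> x)"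
      using add_diff_add[of a \<zero> a "t \<odot> x"] by (simp add: M.minus_eq M.r_neg)
    ultimately have "a \<oplus> t \<odot> x \<in> metric.mball a r" by (simp add: seminorm_minus)
    then have "a \<oplus> t \<odot> x \<in> K N" using ball by blast
    then have 1: "norm (\<phi> n a + t * \<phi> n x) \<le> N" by (simp add: K_def)
    have "a \<in> K N" using ball r by auto
    then have 2: "norm (\<phi> n a) \<le> N" by (simp add: K_def)
    have "norm (t * \<phi> n x) \<le> norm (\<phi> n a + t * \<phi> n x) + norm (\<phi> n a)"
      using norm_triangle_ineq4[of "\<phi> n a + t * \<phi> n x" "\<phi> n a"] by simp
    then have "norm t * norm (\<phi> n x) \<le> 2 * real N" using 1 2 by (simp add: norm_mult)
    then show ?thesis using pos r by (simp add: t field_simps)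
  qed
  then show ?thesis by blast
qed

text \<open>Split \<open>\<phi> n (y n)\<close> into \<open>\<phi> n (y n - b)\<close> and
  \<open>\<phi> n b\<close>. The first part is at most a uniform constant times the norm of
  \<open>y n - b\<close>, the second converges pointwise.\<close>

lemma weak_conv_dual_norm_conv:
  assumes \<phi>: "weak_conv (dual V) \<phi> f" and y: "norm_conv V y b"
  shows "(\<lambda>n. \<phi> n (y n)) \<longlonglongrightarrow> f b"
proof -
  have dual: "\<phi> n \<in> carrier (dual V)" for n using \<phi> by (auto simp: weak_conv_def)
  have [simp]: "y n \<in> carrier V" "b \<in> carrier V" for n
    using y by (auto simp: norm_conv_def)
  have lim: "(\<lambda>n. vnorm V (y n \<ominus> b)) \<longlonglongrightarrow> 0"
    using y by (simp add: norm_conv_def)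
  note ptw = weak_conv_dual_pointwise[OF \<phi>]
  have "\<exists>B. \<forall>n. norm (\<phi> n x) \<le> B" if "x \<in> carrier V" for x
    using convergent_imp_bounded[OF ptw[OF that]] by (auto simp: bounded_iff)
  then obtain B where B: "\<And>n x. x \<in> carrier V \<Longrightarrow> norm (\<phi> n x) \<le> B * vnorm V x"
    using uniform_boundedness[of \<phi>] dual by blast
  have lin: "\<phi> n \<in> linear_ops V scalar_space" for n
    using dual[of n] by (simp add: carrier_dual_iff)
  have "(\<lambda>n. \<phi> n (y n \<ominus> b)) \<longlonglongrightarrow> 0"
    by (rule Lim_null_comparison[OF always_eventually tendsto_mult_right_zero[OF lim, of B]])
      (use B in simp)
  from tendsto_add[OF this ptw[of b]] show ?thesis
    by (simp add: linear_ops_diff[OF seminormed_space scalar_space.seminormed_space lin])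
qed

end

text \<open>A bounded functional composed with \<open>u\<close> is a bounded functional on the
  domain. This will carry weakly null sequences from a copy of the tensor product back to the tensor
  product itself.\<close>

lemma weak_conv_linear_image:
  fixes V :: "('k::real_normed_field, 'v) nspace"
  assumes "normed_space V" "normed_space W" and u: "u \<in> linear_ops V W"
    and bound: "\<And>x. x \<in> carrier V \<Longrightarrow> vnorm W (u x) \<le> C * vnorm V x"
    and s: "weak_conv V s a"
  shows "weak_conv W (\<lambda>n. u (s n)) (u a)"
proof -
  interpret V: normed_space V by fact
  interpret W: normed_space W by fact
  have sa [simp]: "s n \<in> carrier V" "a \<in> carrier V" for n
    using s by (auto simp: weak_conv_def)
  note [simp] = linear_ops_closed[OF u]
  show ?thesis
    unfolding weak_conv_def
  proof (intro conjI ballI)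
    fix f assume f: "f \<in> carrier (dual W)"
    then have lin: "f \<in> linear_ops W scalar_space" by (simp add: W.carrier_dual_iff)
    define g where "g = (\<lambda>x\<in>carrier V. f (u x))"
    have "g \<in> linear_ops V scalar_space"
      by (rule linear_opsI)
        (auto simp: g_def linear_ops_add[OF u] linear_ops_smult[OF u] linear_ops_add[OF lin] linear_ops_smult[OF lin])
    moreover have "norm (g x) \<le> (vnorm (dual W) f * C) * vnorm V x" if x: "x \<in> carrier V" for x
    proof -
      have "norm (g x) \<le> vnorm (dual W) f * vnorm W (u x)"
        using x W.dual_norm_bound[OF f, of "u x"] by (simp add: g_def)
      also have "\<dots> \<le> vnorm (dual W) f * (C * vnorm V x)"
        by (intro mult_left_mono bound x W.dual_norm_nonneg f)
      finally show ?thesis by (simp add: mult.assoc)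
    qed
    ultimately have "g \<in> carrier (dual V)" by (auto simp: V.carrier_dual_iff)
    then have "(\<lambda>n. g (s n)) \<longlonglongrightarrow> g a" using s by (simp add: weak_conv_def)
    then show "(\<lambda>n. f (u (s n))) \<longlonglongrightarrow> f (u a)" by (simp add: g_def)
  qed auto
qed

section \<open>Multilinear operators\<close>

lemma tuples_iff: "x \<in> tuples E \<longleftrightarrow> (\<forall>i. x i \<in> carrier (E i))"
  by (auto simp: tuples_def)

lemma tuples_upd: "x \<in> tuples E \<Longrightarrow> a \<in> carrier (E i) \<Longrightarrow> x(i := a) \<in> tuples E"
  by (auto simp: tuples_iff)

text \<open>The algebraic half of \<open>multilinear_ops\<close>, kept apart so that continuity can
  be exchanged for a product bound in \<open>multilinear_ops_iff\<close>.\<close>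

definition multilinear ::
    "('i::finite \<Rightarrow> ('k::real_normed_field, 'e) nspace) \<Rightarrow> ('k, 'f) nspace \<Rightarrow> (('i \<Rightarrow> 'e) \<Rightarrow> 'f) \<Rightarrow> bool" where
  "multilinear E F T \<longleftrightarrow> T \<in> tuples E \<rightarrow>\<^sub>E carrier F \<and>
     (\<forall>x\<in>tuples E. \<forall>i. (\<lambda>a\<in>carrier (E i). T (x(i := a))) \<in> linear_ops (E i) F)"

context
  fixes E :: "'i::finite \<Rightarrow> ('k::real_normed_field, 'e) nspace"
    and F :: "('k, 'f) nspace" and T
  assumes E: "\<And>i. normed_space (E i)" and F: "normed_space F" and T: "multilinear E F T"
begin

interpretation E: normed_space "E i" for i by (rule E)

interpretation F: normed_space F by (rule F)

lemma multilinear_closed: "x \<in> tuples E \<Longrightarrow> T x \<in> carrier F"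
  using T by (auto simp: multilinear_def)

lemma
  assumes "x \<in> tuples E"
  shows multilinear_add: "a \<in> carrier (E i) \<Longrightarrow> b \<in> carrier (E i) \<Longrightarrow>
      T (x(i := a \<oplus>\<^bsub>E i\<^esub> b)) = T (x(i := a)) \<oplus>\<^bsub>F\<^esub> T (x(i := b))"
    and multilinear_smult: "a \<in> carrier (E i) \<Longrightarrow> T (x(i := t \<odot>\<^bsub>E i\<^esub> a)) = t \<odot>\<^bsub>F\<^esub> T (x(i := a))"
    and multilinear_diff: "a \<in> carrier (E i) \<Longrightarrow> b \<in> carrier (E i) \<Longrightarrow>
      T (x(i := a \<ominus>\<^bsub>E i\<^esub> b)) = T (x(i := a)) \<ominus>\<^bsub>F\<^esub> T (x(i := b))"
proof -
  have lin: "(\<lambda>a\<in>carrier (E i). T (x(i := a))) \<in> linear_ops (E i) F"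
    using T assms by (simp add: multilinear_def)
  show "a \<in> carrier (E i) \<Longrightarrow> b \<in> carrier (E i) \<Longrightarrow>
      T (x(i := a \<oplus>\<^bsub>E i\<^esub> b)) = T (x(i := a)) \<oplus>\<^bsub>F\<^esub> T (x(i := b))"
    using linear_ops_add[OF lin, of a b] by simp
  show "a \<in> carrier (E i) \<Longrightarrow> T (x(i := t \<odot>\<^bsub>E i\<^esub> a)) = t \<odot>\<^bsub>F\<^esub> T (x(i := a))"
    using linear_ops_smult[OF lin, of a t] by simp
  show "a \<in> carrier (E i) \<Longrightarrow> b \<in> carrier (E i) \<Longrightarrow>
      T (x(i := a \<ominus>\<^bsub>E i\<^esub> b)) = T (x(i := a)) \<ominus>\<^bsub>F\<^esub> T (x(i := b))"
    using linear_ops_diff[OF E.seminormed_space F.seminormed_space lin, of a b] by simp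
qed

lemma multilinear_scale_all:
  assumes x: "x \<in> tuples E"
  shows "T (\<lambda>i. t i \<odot>\<^bsub>E i\<^esub> x i) = (\<Prod>i\<in>UNIV. t i) \<odot>\<^bsub>F\<^esub> T x"
proof -
  \<comment> \<open>Only the coordinates in \<open>J\<close> are scaled, so that the induction can
    pull out one scalar at a time.\<close>
  have "T (\<lambda>i. if i \<in> J then t i \<odot>\<^bsub>E i\<^esub> x i else x i) = (\<Prod>i\<in>J. t i) \<odot>\<^bsub>F\<^esub> T x" for J
    using finite[of J]
  proof (induction J rule: finite_induct)
    case empty
    then show ?case using x by (simp add: multilinear_closed)
  next
    case (insert j J)
    define y where "y = (\<lambda>i. if i \<in> J then t i \<odot>\<^bsub>E i\<^esub> x i else x i)"
    have xi: "x i \<in> carrier (E i)" for i using x by (simp add: tuples_iff)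
    then have y: "y \<in> tuples E" by (simp add: y_def tuples_iff)
    have "y(j := x j) = y" "(\<lambda>i. if i \<in> insert j J then t i \<odot>\<^bsub>E i\<^esub> x i else x i) = y(j := t j \<odot>\<^bsub>E j\<^esub> x j)"
      using insert.hyps by (auto simp: y_def)
    then have "T (\<lambda>i. if i \<in> insert j J then t i \<odot>\<^bsub>E i\<^esub> x i else x i) = t j \<odot>\<^bsub>F\<^esub> T y"
      using multilinear_smult[OF y xi] by simp
    then show ?case
      using insert x by (simp add: F.scale_scale multilinear_closed flip: y_def)
  qed
  from this[of UNIV] show ?thesis by simp
qed

lemma multilinear_zero:
  assumes x: "x \<in> tuples E" and "x i = \<zero>\<^bsub>E i\<^esub>"
  shows "T x = \<zero>\<^bsub>F\<^esub>"
proof -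
  have "x(i := 0 \<odot>\<^bsub>E i\<^esub> x i) = x" using assms by auto
  moreover have "x i \<in> carrier (E i)" using x by (simp add: tuples_iff)
  ultimately show ?thesis
    using multilinear_smult[OF x, of "x i" i 0] multilinear_closed[OF x] by simp
qed

text \<open>As in the linear case, but every coordinate is scaled separately into its own ball. This
  needs all coordinates to be nonzero; if one vanishes, so does the value of
  \<open>T\<close>.\<close>

lemma multilinear_continuous_imp_bounded:
  assumes cont: "continuous_map (product_topology (\<lambda>i. norm_topology (E i)) UNIV) (norm_topology F) T"
  shows "\<exists>C. \<forall>x\<in>tuples E. vnorm F (T x) \<le> C * (\<Prod>i\<in>UNIV. vnorm (E i) (x i))"
proof -
  define z where "z = (\<lambda>i. \<zero>\<^bsub>E i\<^esub>)"
  have z: "z \<in> tuples E" by (simp add: z_def tuples_iff)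
  then have Tz: "T z = \<zero>\<^bsub>F\<^esub>" by (rule multilinear_zero) (simp add: z_def)
  have "z \<in> topspace (product_topology (\<lambda>i. norm_topology (E i)) UNIV)"
    using z by (simp add: tuples_def)
  from cont[unfolded F.norm_topology_eq F.metric.continuous_map_to_metric, rule_format, OF this zero_less_one]
  obtain U where U: "openin (product_topology (\<lambda>i. norm_topology (E i)) UNIV) U" "z \<in> U"
      "\<And>y. y \<in> U \<Longrightarrow> T y \<in> F.metric.mball \<zero>\<^bsub>F\<^esub> 1"
    unfolding Tz by blast
  obtain X where X: "\<And>i. z i \<in> X i" "\<And>i. openin (norm_topology (E i)) (X i)" "Pi\<^sub>E UNIV X \<subseteq> U"
    using product_topology_open_contains_basis[OF U(1,2)] by (auto simp: PiE_iff)
  have "\<exists>r>0. E.metric.mball i \<zero>\<^bsub>E i\<^esub> r \<subseteq> X i" for i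
    using X(1,2)[of i] by (simp add: z_def E.norm_topology_eq E.metric.openin_mtopology)
  then obtain r where r: "\<And>i. r i > 0" and ball: "\<And>i. E.metric.mball i \<zero>\<^bsub>E i\<^esub> (r i) \<subseteq> X i"
    by metis
  \<comment> \<open>Coordinate \<open>i\<close> is scaled to norm \<open>r i / 2\<close>. The scaled
    tuple has image of norm below 1, and undoing the scalings costs the factors
    \<open>2 / r i * vnorm (E i) (x i)\<close>.\<close>
  have "vnorm F (T x) \<le> (\<Prod>i\<in>UNIV. 2 / r i) * (\<Prod>i\<in>UNIV. vnorm (E i) (x i))" if x: "x \<in> tuples E" for x
  proof -
    have xi [simp]: "x i \<in> carrier (E i)" for i using x by (simp add: tuples_iff)
    show ?thesis
    proof (cases "\<exists>i. x i = \<zero>\<^bsub>E i\<^esub>")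
      case True
      then obtain i where "x i = \<zero>\<^bsub>E i\<^esub>" by blast
      with multilinear_zero[OF x this] show ?thesis
        by (simp add: mult_nonneg_nonneg prod_nonneg E.vnorm_nonneg less_imp_le[OF r])
    next
      case False
      then have pos: "vnorm (E i) (x i) > 0" for i
        using E.vnorm_nonneg[OF xi] E.vnorm_eq_0[OF xi] by (metis order_less_le)
      define t :: "'i \<Rightarrow> 'k" where "t i = of_real (r i / (2 * vnorm (E i) (x i)))" for i
      have t: "norm (t i) = r i / (2 * vnorm (E i) (x i))" for i
        using pos[of i] r[of i] by (simp add: t_def norm_divide norm_mult)
      have "t i \<odot>\<^bsub>E i\<^esub> x i \<in> X i" for i
      proof -
        have "vnorm (E i) (t i \<odot>\<^bsub>E i\<^esub> x i) < r i"
          using pos[of i] r[of i] by (simp add: E.vnorm_smult t)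
        then show ?thesis by (intro subsetD[OF ball[of i]]) (simp only: E.in_mball_zero, simp)
      qed
      then have "T (\<lambda>i. t i \<odot>\<^bsub>E i\<^esub> x i) \<in> F.metric.mball \<zero>\<^bsub>F\<^esub> 1"
        using X(3) by (intro U(3)) auto
      then have "vnorm F (T (\<lambda>i. t i \<odot>\<^bsub>E i\<^esub> x i)) < 1" by (simp only: F.in_mball_zero)
      then have "(\<Prod>i\<in>UNIV. norm (t i)) * vnorm F (T x) < 1"
        using x by (simp add: multilinear_scale_all F.vnorm_smult multilinear_closed prod_norm)
      moreover have "(\<Prod>i\<in>UNIV. norm (t i)) * ((\<Prod>i\<in>UNIV. 2 / r i) * (\<Prod>i\<in>UNIV. vnorm (E i) (x i))) = 1"
      proof -
        have "norm (t i) * (2 / r i * vnorm (E i) (x i)) = 1" for i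
          using pos[of i] r[of i] by (simp add: t field_simps)
        then show ?thesis by (simp only: prod.neutral_const flip: prod.distrib)
      qed
      moreover have "(\<Prod>i\<in>UNIV. norm (t i)) > 0"
        using pos r by (intro prod_pos) (simp add: t)
      ultimately show ?thesis by (smt (verit) mult_le_cancel_left_pos)
    qed
  qed
  then show ?thesis by blast
qed

text \<open>Telescoping: pass from \<open>a\<close> to \<open>x\<close> by exchanging one coordinate
  at a time. Each exchange changes \<open>T\<close> by its value at a tuple with the difference
  \<open>x j - a j\<close> in slot \<open>j\<close> and entries of norm at most
  \<open>vnorm (E i) (a i) + 1\<close> in the other slots.\<close>

lemma multilinear_diff_bound:
  assumes C: "\<And>x. x \<in> tuples E \<Longrightarrow> vnorm F (T x) \<le> C * (\<Prod>i\<in>UNIV. vnorm (E i) (x i))"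
    and x: "x \<in> tuples E" and a: "a \<in> tuples E"
    and close: "\<And>i. vnorm (E i) (x i \<ominus>\<^bsub>E i\<^esub> a i) \<le> 1"
  shows "vnorm F (T x \<ominus>\<^bsub>F\<^esub> T a) \<le>
    \<bar>C\<bar> * (\<Prod>i\<in>UNIV. vnorm (E i) (a i) + 1) * (\<Sum>i\<in>UNIV. vnorm (E i) (x i \<ominus>\<^bsub>E i\<^esub> a i))"
proof -
  define M where "M = \<bar>C\<bar> * (\<Prod>i\<in>UNIV. vnorm (E i) (a i) + 1)"
  have xi [simp]: "x i \<in> carrier (E i)" and ai [simp]: "a i \<in> carrier (E i)" for i
    using x a by (simp_all add: tuples_iff)
  have nn: "vnorm (E i) (x i \<ominus>\<^bsub>E i\<^esub> a i) \<ge> 0" "vnorm (E i) (a i) \<ge> 0" "vnorm (E i) (x i) \<ge> 0" for i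
    by (simp_all add: E.vnorm_nonneg)
  have xa: "vnorm (E i) (x i) \<le> vnorm (E i) (a i) + 1" for i
    using E.seminorm_diff_ge[OF xi[of i] ai[of i]] close[of i] by simp
  have "vnorm F (T (\<lambda>i. if i \<in> J then x i else a i) \<ominus>\<^bsub>F\<^esub> T a) \<le>
      M * (\<Sum>i\<in>J. vnorm (E i) (x i \<ominus>\<^bsub>E i\<^esub> a i))" for J
    using finite[of J]
  proof (induction J rule: finite_induct)
    case empty
    then show ?case using a by (simp add: multilinear_closed)
  next
    case (insert j J)
    define y where "y = (\<lambda>i. if i \<in> J then x i else a i)"
    define w where "w = (\<lambda>i. if i \<in> insert j J then x i else a i)"
    have y: "y \<in> tuples E" and w: "w \<in> tuples E" by (simp_all add: y_def w_def tuples_iff)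
    have upd: "y(j := x j) = w" "y(j := a j) = y"
      using insert.hyps by (auto simp: y_def w_def)
    have yd: "y(j := x j \<ominus>\<^bsub>E j\<^esub> a j) \<in> tuples E" using y by (simp add: tuples_upd)
    have prod: "(\<Prod>i\<in>UNIV. vnorm (E i) ((y(j := x j \<ominus>\<^bsub>E j\<^esub> a j)) i)) \<le>
        vnorm (E j) (x j \<ominus>\<^bsub>E j\<^esub> a j) * (\<Prod>i\<in>UNIV. vnorm (E i) (a i) + 1)"
    proof -
      \<comment> \<open>Slot \<open>j\<close> also receives the factor
        \<open>vnorm (E j) (a j) + 1\<close>, which is at least 1, so that the product runs over all
        indices and is the same for every \<open>j\<close>.\<close>
      have "(\<Prod>i\<in>UNIV. vnorm (E i) ((y(j := x j \<ominus>\<^bsub>E j\<^esub> a j)) i)) \<le>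
          (\<Prod>i\<in>UNIV. (if i = j then vnorm (E j) (x j \<ominus>\<^bsub>E j\<^esub> a j) else 1) * (vnorm (E i) (a i) + 1))"
      proof (intro prod_mono conjI)
        fix i
        show "0 \<le> vnorm (E i) ((y(j := x j \<ominus>\<^bsub>E j\<^esub> a j)) i)"
          by (simp add: y_def nn)
        show "vnorm (E i) ((y(j := x j \<ominus>\<^bsub>E j\<^esub> a j)) i) \<le>
            (if i = j then vnorm (E j) (x j \<ominus>\<^bsub>E j\<^esub> a j) else 1) * (vnorm (E i) (a i) + 1)"
          using mult_left_mono[of 1 "vnorm (E j) (a j) + 1" "vnorm (E j) (x j \<ominus>\<^bsub>E j\<^esub> a j)"] nn xa
          by (auto simp: y_def)
      qed
      then show ?thesis by (simp add: prod.distrib prod.delta)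
    qed
    have "T w \<ominus>\<^bsub>F\<^esub> T y = T (y(j := x j \<ominus>\<^bsub>E j\<^esub> a j))"
      using multilinear_diff[OF y, where i = j and a = "x j" and b = "a j"] by (simp only: upd) simp
    then have "vnorm F (T w \<ominus>\<^bsub>F\<^esub> T y) \<le> C * (\<Prod>i\<in>UNIV. vnorm (E i) ((y(j := x j \<ominus>\<^bsub>E j\<^esub> a j)) i))"
      using C[OF yd] by simp
    \<comment> \<open>The sign of \<open>C\<close> is unknown; only a nonnegative factor keeps the
      next estimate monotone.\<close>
    also have "\<dots> \<le> \<bar>C\<bar> * (\<Prod>i\<in>UNIV. vnorm (E i) ((y(j := x j \<ominus>\<^bsub>E j\<^esub> a j)) i))"
      using yd by (intro mult_right_mono prod_nonneg) (simp_all add: E.vnorm_nonneg tuples_iff)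
    also have "\<dots> \<le> \<bar>C\<bar> * (vnorm (E j) (x j \<ominus>\<^bsub>E j\<^esub> a j) * (\<Prod>i\<in>UNIV. vnorm (E i) (a i) + 1))"
      by (intro mult_left_mono prod) simp
    also have "\<dots> = M * vnorm (E j) (x j \<ominus>\<^bsub>E j\<^esub> a j)" by (simp add: M_def)
    finally have "vnorm F (T w \<ominus>\<^bsub>F\<^esub> T y) \<le> M * vnorm (E j) (x j \<ominus>\<^bsub>E j\<^esub> a j)" .
    moreover have "vnorm F (T w \<ominus>\<^bsub>F\<^esub> T a) \<le> vnorm F (T w \<ominus>\<^bsub>F\<^esub> T y) + vnorm F (T y \<ominus>\<^bsub>F\<^esub> T a)"
      by (intro F.seminorm_diff_triangle multilinear_closed w y a)
    ultimately show ?case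
      using insert by (simp add: w_def y_def distrib_left)
  qed
  from this[of UNIV] show ?thesis by (simp add: M_def)
qed

lemma multilinear_bounded_imp_continuous:
  assumes C: "\<And>x. x \<in> tuples E \<Longrightarrow> vnorm F (T x) \<le> C * (\<Prod>i\<in>UNIV. vnorm (E i) (x i))"
  shows "continuous_map (product_topology (\<lambda>i. norm_topology (E i)) UNIV) (norm_topology F) T"
  unfolding F.norm_topology_eq F.metric.continuous_map_to_metric
proof (intro ballI allI impI)
  fix a and e :: real
  assume "a \<in> topspace (product_topology (\<lambda>i. norm_topology (E i)) UNIV)" and e: "e > 0"
  then have a: "a \<in> tuples E" by (simp add: tuples_def)
  then have ai [simp]: "a i \<in> carrier (E i)" for i by (simp add: tuples_iff)
  define M where "M = \<bar>C\<bar> * (\<Prod>i\<in>UNIV. vnorm (E i) (a i) + 1)"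
  have M: "M \<ge> 0" by (simp add: M_def mult_nonneg_nonneg prod_nonneg E.vnorm_nonneg)
  define n where "n = real CARD('i)"
  have n: "n > 0" by (simp add: n_def)
  \<comment> \<open>The bound 1 is the closeness condition of \<open>multilinear_diff_bound\<close>.
    The other term makes \<open>n\<close> summands of size \<open>d\<close>, multiplied by
    \<open>M\<close>, at most \<open>e / 2\<close>, with \<open>M + 1\<close> guarding against
    \<open>M = 0\<close>.\<close>
  define d where "d = min 1 (e / (2 * (M + 1) * n))"
  have d: "d > 0" "d \<le> 1" using e M n by (simp_all add: d_def)
  define U where "U = Pi\<^sub>E UNIV (\<lambda>i. E.metric.mball i (a i) d)"
  have "openin (product_topology (\<lambda>i. norm_topology (E i)) UNIV) U"
    unfolding U_def by (rule product_topology_basis) (auto simp: E.norm_topology_eq)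
  moreover have "a \<in> U" using d by (simp add: U_def PiE_iff)
  moreover have "T x \<in> F.metric.mball (T a) e" if "x \<in> U" for x
  proof -
    have ball: "x i \<in> E.metric.mball i (a i) d" for i using that by (simp add: U_def PiE_iff del: E.metric.in_mball)
    then have xi [simp]: "x i \<in> carrier (E i)" for i by simp
    have dist: "vnorm (E i) (x i \<ominus>\<^bsub>E i\<^esub> a i) < d" for i
      using ball[of i] E.seminorm_diff_commute[OF xi[of i] ai[of i]] by simp
    have x: "x \<in> tuples E" by (simp add: tuples_iff)
    have "vnorm F (T x \<ominus>\<^bsub>F\<^esub> T a) \<le> M * (\<Sum>i\<in>UNIV. vnorm (E i) (x i \<ominus>\<^bsub>E i\<^esub> a i))"
      unfolding M_def using d dist by (intro multilinear_diff_bound C x a) (auto intro: less_imp_le order.strict_trans2)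
    also have "\<dots> \<le> M * (n * d)"
      unfolding n_def using M sum_bounded_above[of UNIV "\<lambda>i. vnorm (E i) (x i \<ominus>\<^bsub>E i\<^esub> a i)" d] dist
      by (intro mult_left_mono) (auto simp: less_imp_le)
    also have "\<dots> \<le> (M + 1) * (n * d)" using n d by (intro mult_right_mono) auto
    also have "\<dots> \<le> e / 2"
    proof -
      have "d \<le> e / (2 * (M + 1) * n)" by (simp add: d_def)
      moreover have "2 * (M + 1) * n > 0" using M n by simp
      ultimately have "d * (2 * (M + 1) * n) \<le> e" by (simp only: pos_le_divide_eq)
      then show ?thesis by (simp add: algebra_simps)
    qed
    also have "\<dots> < e" using e by simp
    finally show ?thesis using x a by (simp add: multilinear_closed F.seminorm_diff_commute[of "T a"])
  qed
  ultimately show "\<exists>U. openin (product_topology (\<lambda>i. norm_topology (E i)) UNIV) U \<and> a \<in> U \<and>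
      (\<forall>y\<in>U. T y \<in> F.metric.mball (T a) e)" by blast
qed

end

lemma multilinear_ops_iff:
  assumes "\<And>i. normed_space (E i)" and "normed_space F"
  shows "T \<in> multilinear_ops E F \<longleftrightarrow> multilinear E F T \<and>
    (\<exists>C. \<forall>x\<in>tuples E. vnorm F (T x) \<le> C * (\<Prod>i\<in>UNIV. vnorm (E i) (x i)))"
proof -
  have "T \<in> multilinear_ops E F \<longleftrightarrow> multilinear E F T \<and>
      continuous_map (product_topology (\<lambda>i. norm_topology (E i)) UNIV) (norm_topology F) T"
    by (simp add: multilinear_ops_def multilinear_def conj_assoc)
  moreover have "continuous_map (product_topology (\<lambda>i. norm_topology (E i)) UNIV) (norm_topology F) T \<longleftrightarrow>
      (\<exists>C. \<forall>x\<in>tuples E. vnorm F (T x) \<le> C * (\<Prod>i\<in>UNIV. vnorm (E i) (x i)))" if T: "multilinear E F T"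
  proof
    assume "\<exists>C. \<forall>x\<in>tuples E. vnorm F (T x) \<le> C * (\<Prod>i\<in>UNIV. vnorm (E i) (x i))"
    then obtain C where "\<And>x. x \<in> tuples E \<Longrightarrow> vnorm F (T x) \<le> C * (\<Prod>i\<in>UNIV. vnorm (E i) (x i))"
      by blast
    then show "continuous_map (product_topology (\<lambda>i. norm_topology (E i)) UNIV) (norm_topology F) T"
      by (rule multilinear_bounded_imp_continuous[OF assms T])
  qed (rule multilinear_continuous_imp_bounded[OF assms T])
  ultimately show ?thesis by blast
qed

text \<open>Convergence in a product topology is coordinatewise, so joint continuity applies
  directly to the sequence of tuples.\<close>

lemma multilinear_ops_norm_conv:
  assumes E: "\<And>i. normed_space (E i)" and F: "normed_space F" and T: "T \<in> multilinear_ops E F"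
    and x: "\<And>i. norm_conv (E i) (x i) (a i)"
  shows "norm_conv F (\<lambda>n. T (\<lambda>i. x i n)) (T a)"
proof -
  interpret E: normed_space "E i" for i by (rule E)
  interpret F: normed_space F by (rule F)
  have xi: "x i n \<in> carrier (E i)" and a: "a i \<in> carrier (E i)" for i n
    using x[of i] by (auto simp: norm_conv_def)
  have cont: "continuous_map (product_topology (\<lambda>i. norm_topology (E i)) UNIV) (norm_topology F) T"
    and T': "T \<in> tuples E \<rightarrow>\<^sub>E carrier F"
    using T by (auto simp: multilinear_ops_def)
  have "limitin (norm_topology (E i)) (x i) (a i) sequentially" for i
    using x[of i] xi[of i] E.norm_conv_iff_limitin[of "x i" i "a i"] by auto
  then have "limitin (product_topology (\<lambda>i. norm_topology (E i)) UNIV) (\<lambda>n i. x i n) a sequentially"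
    by (simp add: limitin_componentwise xi PiE_iff)
  from continuous_map_limit[OF cont this] show ?thesis
    using T' xi by (subst F.norm_conv_iff_limitin) (auto simp: comp_def tuples_iff Pi_iff)
qed

lemma multilinear_ops_subset_L_WDP_ev:
  assumes "\<And>i. banach_space (E i)" "banach_space F" "\<And>i. schur_property (E i)"
  shows "multilinear_ops E F \<subseteq> L_WDP_ev E F"
proof
  fix T assume T: "T \<in> multilinear_ops E F"
  interpret E: banach_space "E i" for i by fact
  interpret F: banach_space F by fact
  show "T \<in> L_WDP_ev E F"
    unfolding L_WDP_ev_def
  proof (intro CollectI conjI T ballI allI impI)
    fix a x \<phi> f
    assume "\<forall>i. weak_conv (E i) (x i) (a i)" and \<phi>: "weak_conv (dual F) \<phi> f"
    then have "norm_conv (E i) (x i) (a i)" for i using assms(3) by (simp add: schur_property_def)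
    from multilinear_ops_norm_conv[OF E.normed_space_axioms F.normed_space_axioms T this]
    show "(\<lambda>j. \<phi> j (T (\<lambda>i. x i j))) \<longlonglongrightarrow> f (T a)"
      by (rule F.weak_conv_dual_norm_conv[OF \<phi>])
  qed
qed

section \<open>Completion of a seminormed space\<close>

context seminormed_space
begin

lemma cauchy_seqsI:
  assumes "\<And>n. s n \<in> carrier V"
    and "\<And>e. e > 0 \<Longrightarrow> \<exists>N. \<forall>m\<ge>N. \<forall>n\<ge>N. vnorm V (s m \<ominus> s n) < e"
  shows "s \<in> cauchy_seqs V"
  using assms by (auto simp: cauchy_seqs_def)

lemma cauchy_seqs_closed [intro]: "s \<in> cauchy_seqs V \<Longrightarrow> s n \<in> carrier V"
  by (auto simp: cauchy_seqs_def)

lemma cauchy_seqsD: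
  "s \<in> cauchy_seqs V \<Longrightarrow> e > 0 \<Longrightarrow> \<exists>N. \<forall>m\<ge>N. \<forall>n\<ge>N. vnorm V (s m \<ominus> s n) < e"
  by (auto simp: cauchy_seqs_def)

lemma cauchy_seqs_const: "x \<in> carrier V \<Longrightarrow> (\<lambda>n. x) \<in> cauchy_seqs V"
  by (rule cauchy_seqsI) auto

lemma cauchy_seqs_add:
  assumes s: "s \<in> cauchy_seqs V" and t: "t \<in> cauchy_seqs V"
  shows "(\<lambda>n. s n \<oplus> t n) \<in> cauchy_seqs V"
proof (rule cauchy_seqsI)
  note [simp] = cauchy_seqs_closed[OF s] cauchy_seqs_closed[OF t]
  show "s n \<oplus> t n \<in> carrier V" for n by simp
  fix e :: real assume "e > 0"
  then have e: "e / 2 > 0" by simp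
  obtain M where M: "\<And>m n. m \<ge> M \<Longrightarrow> n \<ge> M \<Longrightarrow> vnorm V (s m \<ominus> s n) < e / 2"
    using cauchy_seqsD[OF s e] by blast
  obtain N where N: "\<And>m n. m \<ge> N \<Longrightarrow> n \<ge> N \<Longrightarrow> vnorm V (t m \<ominus> t n) < e / 2"
    using cauchy_seqsD[OF t e] by blast
  have "vnorm V ((s m \<oplus> t m) \<ominus> (s n \<oplus> t n)) < e" if "m \<ge> max M N" "n \<ge> max M N" for m n
    using M[of m n] N[of m n] that seminorm_triangle[of "s m \<ominus> s n" "t m \<ominus> t n"]
    by (simp add: add_diff_add)
  then show "\<exists>N. \<forall>m\<ge>N. \<forall>n\<ge>N. vnorm V (s m \<oplus> t m \<ominus> (s n \<oplus> t n)) < e" by blast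
qed

lemma cauchy_seqs_smult:
  assumes s: "s \<in> cauchy_seqs V"
  shows "(\<lambda>n. c \<odot> s n) \<in> cauchy_seqs V"
proof (rule cauchy_seqsI)
  note [simp] = cauchy_seqs_closed[OF s]
  show "c \<odot> s n \<in> carrier V" for n by simp
  fix e :: real assume "e > 0"
  have c: "norm c + 1 > 0" using norm_ge_zero[of c] by linarith
  then have "e / (norm c + 1) > 0" using \<open>e > 0\<close> by simp
  then obtain N where N: "\<And>m n. m \<ge> N \<Longrightarrow> n \<ge> N \<Longrightarrow> vnorm V (s m \<ominus> s n) < e / (norm c + 1)"
    using cauchy_seqsD[OF s] by blast
  have "vnorm V (c \<odot> s m \<ominus> c \<odot> s n) < e" if "m \<ge> N" "n \<ge> N" for m n
  proof -
    have "vnorm V (c \<odot> s m \<ominus> c \<odot> s n) = norm c * vnorm V (s m \<ominus> s n)"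
      by (simp add: seminorm_smult flip: scale_diff)
    also have "\<dots> \<le> (norm c + 1) * vnorm V (s m \<ominus> s n)"
      by (intro mult_right_mono seminorm_nonneg) auto
    also have "\<dots> < e" using N[OF that] c by (simp add: pos_less_divide_eq mult.commute)
    finally show ?thesis .
  qed
  then show "\<exists>N. \<forall>m\<ge>N. \<forall>n\<ge>N. vnorm V (c \<odot> s m \<ominus> c \<odot> s n) < e" by blast
qed

lemma cauchy_seqs_diff:
  assumes s: "s \<in> cauchy_seqs V" and t: "t \<in> cauchy_seqs V"
  shows "(\<lambda>n. s n \<ominus> t n) \<in> cauchy_seqs V"
  using cauchy_seqs_add[OF s cauchy_seqs_smult[OF t, of "- 1"]]
  by (simp add: diff_scale cauchy_seqs_closed[OF s] cauchy_seqs_closed[OF t])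

lemma null_rel_iff:
  "(s, t) \<in> null_rel V \<longleftrightarrow> s \<in> cauchy_seqs V \<and> t \<in> cauchy_seqs V \<and> (\<lambda>n. vnorm V (s n \<ominus> t n)) \<longlonglongrightarrow> 0"
  by (simp add: null_rel_def)

lemma equiv_null_rel: "equiv (cauchy_seqs V) (null_rel V)"
proof (rule equivI)
  show "null_rel V \<subseteq> cauchy_seqs V \<times> cauchy_seqs V" by (auto simp: null_rel_iff)
  show "refl_on (cauchy_seqs V) (null_rel V)"
    by (rule refl_onI) (simp_all add: null_rel_iff cauchy_seqs_closed)
  show "sym (null_rel V)"
    by (rule symI) (auto simp: null_rel_iff seminorm_diff_commute cauchy_seqs_closed)
  show "trans (null_rel V)"
  proof (rule transI)
    fix s t w assume "(s, t) \<in> null_rel V" "(t, w) \<in> null_rel V"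
    then have c: "s \<in> cauchy_seqs V" "t \<in> cauchy_seqs V" "w \<in> cauchy_seqs V"
      and l: "(\<lambda>n. vnorm V (s n \<ominus> t n)) \<longlonglongrightarrow> 0" "(\<lambda>n. vnorm V (t n \<ominus> w n)) \<longlonglongrightarrow> 0"
      by (auto simp: null_rel_iff)
    have "(\<lambda>n. vnorm V (s n \<ominus> w n)) \<longlonglongrightarrow> 0"
      by (rule tendsto_sandwich[OF _ _ tendsto_const tendsto_add_zero[OF l]])
        (simp_all add: seminorm_nonneg seminorm_diff_triangle cauchy_seqs_closed c)
    then show "(s, w) \<in> null_rel V" using c by (simp add: null_rel_iff)
  qed
qed

section \<open>Operations and norm on classes of Cauchy sequences\<close>

definition cls :: "(nat \<Rightarrow> 'v) \<Rightarrow> (nat \<Rightarrow> 'v) set" where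
  "cls s = null_rel V `` {s}"

lemma cls_eq_iff:
  assumes "s \<in> cauchy_seqs V" "t \<in> cauchy_seqs V"
  shows "cls s = cls t \<longleftrightarrow> (\<lambda>n. vnorm V (s n \<ominus> t n)) \<longlonglongrightarrow> 0"
  using eq_equiv_class_iff[OF equiv_null_rel assms] assms by (simp add: cls_def null_rel_iff)

lemma cls_self: "s \<in> cauchy_seqs V \<Longrightarrow> s \<in> cls s"
  unfolding cls_def by (rule equiv_class_self[OF equiv_null_rel])

lemma in_cls_iff: "t \<in> cls s \<longleftrightarrow> (s, t) \<in> null_rel V"
  by (simp add: cls_def)

lemma carrier_completion: "carrier (completion V) = cls ` cauchy_seqs V"
  by (auto simp: completion_def quotient_def cls_def)

lemma zero_completion: "\<zero>\<^bsub>completion V\<^esub> = cls (\<lambda>n. \<zero>)"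
  by (simp add: completion_def cls_def)

text \<open>The sum of two classes is a union over all pairs of representatives. As null differences
  add up to null differences, every member of the union is the same class.\<close>

lemma add_completion:
  assumes s: "s \<in> cauchy_seqs V" and t: "t \<in> cauchy_seqs V"
  shows "cls s \<oplus>\<^bsub>completion V\<^esub> cls t = cls (\<lambda>n. s n \<oplus> t n)"
proof -
  have "congruent2 (null_rel V) (null_rel V) (\<lambda>s t. null_rel V `` {\<lambda>n. s n \<oplus> t n})"
  proof (rule congruent2I')
    fix s s' t t' assume "(s, s') \<in> null_rel V" "(t, t') \<in> null_rel V"
    then have c: "s \<in> cauchy_seqs V" "s' \<in> cauchy_seqs V" "t \<in> cauchy_seqs V" "t' \<in> cauchy_seqs V"
      and l: "(\<lambda>n. vnorm V (s n \<ominus> s' n)) \<longlonglongrightarrow> 0" "(\<lambda>n. vnorm V (t n \<ominus> t' n)) \<longlonglongrightarrow> 0"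
      by (auto simp: null_rel_iff)
    have "(\<lambda>n. vnorm V ((s n \<oplus> t n) \<ominus> (s' n \<oplus> t' n))) \<longlonglongrightarrow> 0"
      by (rule tendsto_sandwich[OF _ _ tendsto_const tendsto_add_zero[OF l]])
        (simp_all add: add_diff_add seminorm_nonneg seminorm_triangle cauchy_seqs_closed c)
    then show "null_rel V `` {\<lambda>n. s n \<oplus> t n} = null_rel V `` {\<lambda>n. s' n \<oplus> t' n}"
      using c cls_eq_iff[OF cauchy_seqs_add cauchy_seqs_add] by (simp add: cls_def)
  qed
  from UN_equiv_class2[OF equiv_null_rel equiv_null_rel this s t] show ?thesis
    by (simp add: completion_def cls_def)
qed

lemma smult_completion:
  assumes s: "s \<in> cauchy_seqs V"
  shows "c \<odot>\<^bsub>completion V\<^esub> cls s = cls (\<lambda>n. c \<odot> s n)"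
proof -
  have "congruent (null_rel V) (\<lambda>s. null_rel V `` {\<lambda>n. c \<odot> s n})"
  proof (rule congruentI)
    fix s s' assume "(s, s') \<in> null_rel V"
    then have c: "s \<in> cauchy_seqs V" "s' \<in> cauchy_seqs V"
      and l: "(\<lambda>n. vnorm V (s n \<ominus> s' n)) \<longlonglongrightarrow> 0"
      by (auto simp: null_rel_iff)
    have "(\<lambda>n. vnorm V (c \<odot> s n \<ominus> c \<odot> s' n)) \<longlonglongrightarrow> 0"
      using tendsto_mult_right_zero[OF l, of "norm c"]
      by (simp add: seminorm_smult cauchy_seqs_closed c flip: scale_diff)
    then show "null_rel V `` {\<lambda>n. c \<odot> s n} = null_rel V `` {\<lambda>n. c \<odot> s' n}"
      using c cls_eq_iff[OF cauchy_seqs_smult cauchy_seqs_smult] by (simp add: cls_def)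
  qed
  from UN_equiv_class[OF equiv_null_rel this s] show ?thesis
    by (simp add: completion_def cls_def)
qed

text \<open>Gives the \<open>THE\<close> in the norm a meaning. By the reverse triangle inequality
  the norms along a Cauchy sequence form a Cauchy sequence of reals, and equivalent sequences have
  the same limit.\<close>

lemma norm_completion:
  assumes s: "s \<in> cauchy_seqs V"
  shows "(\<lambda>n. vnorm V (s n)) \<longlonglongrightarrow> vnorm (completion V) (cls s)"
proof -
  have "Cauchy (\<lambda>n. vnorm V (s n))"
  proof (rule metric_CauchyI)
    fix e :: real assume "e > 0"
    then obtain N where N: "\<And>m n. m \<ge> N \<Longrightarrow> n \<ge> N \<Longrightarrow> vnorm V (s m \<ominus> s n) < e"
      using cauchy_seqsD[OF s] by blast
    have "dist (vnorm V (s m)) (vnorm V (s n)) < e" if "m \<ge> N" "n \<ge> N" for m n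
      using N[OF that] seminorm_diff_ge[of "s m" "s n"] cauchy_seqs_closed[OF s] by (simp add: dist_real_def)
    then show "\<exists>M. \<forall>m\<ge>M. \<forall>n\<ge>M. dist (vnorm V (s m)) (vnorm V (s n)) < e" by blast
  qed
  then obtain r where r: "(\<lambda>n. vnorm V (s n)) \<longlonglongrightarrow> r"
    using Cauchy_convergent convergent_def by blast
  have "(\<lambda>n. vnorm V (t n)) \<longlonglongrightarrow> r" if "t \<in> cls s" for t
  proof -
    have t: "t \<in> cauchy_seqs V" and l: "(\<lambda>n. vnorm V (s n \<ominus> t n)) \<longlonglongrightarrow> 0"
      using that by (auto simp: in_cls_iff null_rel_iff)
    have "(\<lambda>n. vnorm V (t n) - vnorm V (s n)) \<longlonglongrightarrow> 0"
      by (rule Lim_null_comparison[OF always_eventually l])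
        (use seminorm_diff_ge cauchy_seqs_closed[OF s] cauchy_seqs_closed[OF t] in \<open>simp add: abs_minus_commute\<close>)
    from tendsto_add[OF this r] show ?thesis by simp
  qed
  then have "\<forall>t\<in>cls s. (\<lambda>n. vnorm V (t n)) \<longlonglongrightarrow> r" by blast
  moreover have "q = r" if "\<forall>t\<in>cls s. (\<lambda>n. vnorm V (t n)) \<longlonglongrightarrow> q" for q
    using that r cls_self[OF s] LIMSEQ_unique by blast
  ultimately have "vnorm (completion V) (cls s) = r"
    unfolding completion_def nspace.simps by (rule the_equality)
  then show ?thesis using r by simp
qed

lemma normed_space_completion: "normed_space (completion V)"
proof (intro normed_space.intro normed_space_axioms.intro)
  note closed = cauchy_seqs_const cauchy_seqs_add cauchy_seqs_smult
  show "Module.module scalars (completion V)"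
    by (rule module_scalarsI)
      (auto simp: carrier_completion zero_completion add_completion smult_completion closed
        M.a_ac scale_add_left scale_add_right scale_scale cauchy_seqs_closed)
  fix A assume "A \<in> carrier (completion V)"
  then obtain s where s: "s \<in> cauchy_seqs V" and A: "A = cls s" by (auto simp: carrier_completion)
  show "0 \<le> vnorm (completion V) A"
    unfolding A by (rule LIMSEQ_le_const[OF norm_completion[OF s]]) (auto simp: seminorm_nonneg cauchy_seqs_closed[OF s])
  show "vnorm (completion V) A = 0 \<longleftrightarrow> A = \<zero>\<^bsub>completion V\<^esub>"
  proof -
    have "vnorm (completion V) A = 0 \<longleftrightarrow> (\<lambda>n. vnorm V (s n)) \<longlonglongrightarrow> 0"
      unfolding A using norm_completion[OF s] LIMSEQ_unique by auto
    also have "\<dots> \<longleftrightarrow> A = \<zero>\<^bsub>completion V\<^esub>"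
      unfolding A zero_completion using cls_eq_iff[OF s cauchy_seqs_const[of \<zero>]]
      by (simp add: cauchy_seqs_closed[OF s])
    finally show ?thesis .
  qed
  show "vnorm (completion V) (t \<odot>\<^bsub>completion V\<^esub> A) = norm t * vnorm (completion V) A" for t
  proof (rule LIMSEQ_unique)
    show "(\<lambda>n. vnorm V (t \<odot> s n)) \<longlonglongrightarrow> vnorm (completion V) (t \<odot>\<^bsub>completion V\<^esub> A)"
      unfolding A smult_completion[OF s] by (rule norm_completion[OF cauchy_seqs_smult[OF s]])
    show "(\<lambda>n. vnorm V (t \<odot> s n)) \<longlonglongrightarrow> norm t * vnorm (completion V) A"
      unfolding A by (simp add: seminorm_smult cauchy_seqs_closed[OF s] tendsto_mult_left norm_completion[OF s])
  qed
  fix B assume "B \<in> carrier (completion V)"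
  then obtain t where t: "t \<in> cauchy_seqs V" and B: "B = cls t" by (auto simp: carrier_completion)
  show "vnorm (completion V) (A \<oplus>\<^bsub>completion V\<^esub> B) \<le> vnorm (completion V) A + vnorm (completion V) B"
    unfolding A B add_completion[OF s t]
    by (rule LIMSEQ_le[OF norm_completion[OF cauchy_seqs_add[OF s t]] tendsto_add[OF norm_completion[OF s] norm_completion[OF t]]])
      (auto intro!: seminorm_triangle simp: cauchy_seqs_closed[OF s] cauchy_seqs_closed[OF t])
qed

interpretation completion: normed_space "completion V"
  by (rule normed_space_completion)

lemma diff_completion:
  assumes "s \<in> cauchy_seqs V" "t \<in> cauchy_seqs V"
  shows "cls s \<ominus>\<^bsub>completion V\<^esub> cls t = cls (\<lambda>n. s n \<ominus> t n)"
  using assms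
  by (simp add: completion.diff_scale carrier_completion smult_completion add_completion cauchy_seqs_smult
      diff_scale cauchy_seqs_closed)

lemma cls_closed [simp, intro]: "s \<in> cauchy_seqs V \<Longrightarrow> cls s \<in> carrier (completion V)"
  by (simp add: carrier_completion)

text \<open>Elements of \<open>V\<close> at distance zero have the same image, so over a seminormed
  space this isometry need not be injective.\<close>

definition emb :: "'v \<Rightarrow> (nat \<Rightarrow> 'v) set" where
  "emb x = cls (\<lambda>n. x)"

lemma
  assumes x: "x \<in> carrier V"
  shows emb_closed [simp]: "emb x \<in> carrier (completion V)"
    and norm_emb [simp]: "vnorm (completion V) (emb x) = vnorm V x"
    and emb_add: "y \<in> carrier V \<Longrightarrow> emb (x \<oplus> y) = emb x \<oplus>\<^bsub>completion V\<^esub> emb y"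
    and emb_smult: "emb (t \<odot> x) = t \<odot>\<^bsub>completion V\<^esub> emb x"
    and emb_diff: "y \<in> carrier V \<Longrightarrow> emb (x \<ominus> y) = emb x \<ominus>\<^bsub>completion V\<^esub> emb y"
  using x LIMSEQ_unique[OF norm_completion[OF cauchy_seqs_const[OF x]] tendsto_const]
  by (simp_all add: emb_def cauchy_seqs_const add_completion smult_completion diff_completion)

text \<open>The distance from \<open>emb (s k)\<close> to the class of \<open>s\<close> is the limit
  over \<open>n\<close> of the distances from \<open>s k\<close> to \<open>s n\<close>, which are
  small for large \<open>k\<close>.\<close>

lemma emb_tendsto:
  assumes s: "s \<in> cauchy_seqs V"
  shows "norm_conv (completion V) (\<lambda>k. emb (s k)) (cls s)"
  unfolding norm_conv_def
proof (intro conjI)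
  show "range (\<lambda>k. emb (s k)) \<subseteq> carrier (completion V)" by (auto simp: cauchy_seqs_closed[OF s])
  show "cls s \<in> carrier (completion V)" using s by simp
  show "(\<lambda>k. vnorm (completion V) (emb (s k) \<ominus>\<^bsub>completion V\<^esub> cls s)) \<longlonglongrightarrow> 0"
  proof (rule LIMSEQ_I)
    fix e :: real assume e: "e > 0"
    then have "e / 2 > 0" by simp
    then obtain N where N: "\<And>m n. m \<ge> N \<Longrightarrow> n \<ge> N \<Longrightarrow> vnorm V (s m \<ominus> s n) < e / 2"
      using cauchy_seqsD[OF s] by blast
    have "norm (vnorm (completion V) (emb (s k) \<ominus>\<^bsub>completion V\<^esub> cls s) - 0) < e" if k: "k \<ge> N" for k
    proof -
      have c: "(\<lambda>n. s k) \<in> cauchy_seqs V" by (simp add: cauchy_seqs_const cauchy_seqs_closed[OF s])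
      \<comment> \<open>Strict inequalities become weak in the limit; starting from
        \<open>e / 2\<close> leaves room for a strict bound by \<open>e\<close>.\<close>
      have "vnorm (completion V) (cls (\<lambda>n. s k \<ominus> s n)) \<le> e / 2"
        by (rule LIMSEQ_le_const2[OF norm_completion[OF cauchy_seqs_diff[OF c s]]])
          (use N k in \<open>auto intro!: exI[of _ N] less_imp_le\<close>)
      then show ?thesis
        using e completion.vnorm_nonneg[OF cls_closed[OF cauchy_seqs_diff[OF c s]]]
        by (simp add: emb_def diff_completion[OF c s])
    qed
    then show "\<exists>N. \<forall>k\<ge>N. norm (vnorm (completion V) (emb (s k) \<ominus>\<^bsub>completion V\<^esub> cls s) - 0) < e" by blast
  qed
qed

lemma emb_dense:
  assumes "A \<in> carrier (completion V)" "e > 0"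
  shows "\<exists>x\<in>carrier V. vnorm (completion V) (A \<ominus>\<^bsub>completion V\<^esub> emb x) < e"
proof -
  obtain s where s: "s \<in> cauchy_seqs V" and A: "A = cls s" using assms by (auto simp: carrier_completion)
  have "(\<lambda>k. vnorm (completion V) (emb (s k) \<ominus>\<^bsub>completion V\<^esub> A)) \<longlonglongrightarrow> 0"
    using emb_tendsto[OF s] by (simp add: norm_conv_def A)
  then have "\<forall>\<^sub>F k in sequentially. vnorm (completion V) (emb (s k) \<ominus>\<^bsub>completion V\<^esub> A) < e"
    using assms(2) by (rule order_tendstoD)
  then obtain k where "vnorm (completion V) (emb (s k) \<ominus>\<^bsub>completion V\<^esub> A) < e"
    by (auto simp: eventually_sequentially)
  then show ?thesis
    using assms(1) cauchy_seqs_closed[OF s, of k] completion.seminorm_diff_commute[of A "emb (s k)"]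
    by (intro bexI[of _ "s k"]) auto
qed

text \<open>Diagonal argument: replace the \<open>k\<close>-th term of a Cauchy sequence of classes
  by an element of \<open>V\<close> within \<open>1 / (k + 1)\<close> of it. These elements form a
  Cauchy sequence in \<open>V\<close>, and its class is the limit.\<close>

lemma banach_space_completion: "banach_space (completion V)"
proof (intro banach_space.intro banach_space_axioms.intro normed_space_completion)
  fix S assume S: "S \<in> cauchy_seqs (completion V)"
  then have Sc [simp]: "S n \<in> carrier (completion V)" for n by (rule completion.cauchy_seqs_closed)
  have "\<exists>x\<in>carrier V. vnorm (completion V) (S k \<ominus>\<^bsub>completion V\<^esub> emb x) < inverse (real (Suc k))" for k
    by (rule emb_dense) auto
  then have "\<exists>x. \<forall>k. x k \<in> carrier V \<and>
      vnorm (completion V) (S k \<ominus>\<^bsub>completion V\<^esub> emb (x k)) < inverse (real (Suc k))"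
    by (intro choice) blast
  then obtain x where x [simp]: "\<And>k. x k \<in> carrier V"
    and close: "\<And>k. vnorm (completion V) (S k \<ominus>\<^bsub>completion V\<^esub> emb (x k)) < inverse (real (Suc k))"
    by blast
  have "x \<in> cauchy_seqs V"
  proof (rule cauchy_seqsI)
    fix e :: real assume "e > 0"
    then have e: "e / 3 > 0" by simp
    obtain M where M: "\<And>m n. m \<ge> M \<Longrightarrow> n \<ge> M \<Longrightarrow> vnorm (completion V) (S m \<ominus>\<^bsub>completion V\<^esub> S n) < e / 3"
      using completion.cauchy_seqsD[OF S e] by blast
    obtain N where N: "inverse (real (Suc N)) < e / 3" using reals_Archimedean[OF e] by blast
    have "vnorm V (x m \<ominus> x n) < e" if m: "m \<ge> max M N" and n: "n \<ge> max M N" for m n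
    proof -
      have small: "vnorm (completion V) (S k \<ominus>\<^bsub>completion V\<^esub> emb (x k)) < e / 3" if "k \<ge> N" for k
        using close[of k] N that le_imp_inverse_le[of "real (Suc N)" "real (Suc k)"] by linarith
      have "vnorm V (x m \<ominus> x n) = vnorm (completion V) (emb (x m) \<ominus>\<^bsub>completion V\<^esub> emb (x n))"
        by (simp flip: emb_diff)
      also have "\<dots> \<le> vnorm (completion V) (emb (x m) \<ominus>\<^bsub>completion V\<^esub> S m) +
          (vnorm (completion V) (S m \<ominus>\<^bsub>completion V\<^esub> S n) + vnorm (completion V) (S n \<ominus>\<^bsub>completion V\<^esub> emb (x n)))"
        by (intro order_trans[OF completion.seminorm_diff_triangle[of _ "S m"]] add_left_mono
            completion.seminorm_diff_triangle) auto
      also have "\<dots> < e / 3 + (e / 3 + e / 3)"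
        using small[of m] small[of n] M[of m n] m n
        by (simp add: completion.seminorm_diff_commute[of "emb (x m)"])
      finally show ?thesis by simp
    qed
    then show "\<exists>N. \<forall>m\<ge>N. \<forall>n\<ge>N. vnorm V (x m \<ominus> x n) < e" by blast
  qed simp
  then have conv: "norm_conv (completion V) (\<lambda>k. emb (x k)) (cls x)" and cls [simp]: "cls x \<in> carrier (completion V)"
    by (auto intro: emb_tendsto)
  have lim: "(\<lambda>k. inverse (real (Suc k)) + vnorm (completion V) (emb (x k) \<ominus>\<^bsub>completion V\<^esub> cls x)) \<longlonglongrightarrow> 0"
    using conv LIMSEQ_inverse_real_of_nat by (intro tendsto_add_zero) (auto simp: norm_conv_def)
  have "vnorm (completion V) (S k \<ominus>\<^bsub>completion V\<^esub> cls x) \<le>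
      inverse (real (Suc k)) + vnorm (completion V) (emb (x k) \<ominus>\<^bsub>completion V\<^esub> cls x)" for k
    using completion.seminorm_diff_triangle[of "S k" "emb (x k)" "cls x"] close[of k] by simp
  then have "(\<lambda>k. vnorm (completion V) (S k \<ominus>\<^bsub>completion V\<^esub> cls x)) \<longlonglongrightarrow> 0"
    by (intro tendsto_sandwich[OF _ _ tendsto_const lim]) (simp_all add: completion.vnorm_nonneg)
  then have "norm_conv (completion V) S (cls x)" by (auto simp: norm_conv_def)
  then show "\<exists>a. norm_conv (completion V) S a" ..
qed

end

lemma (in normed_space)
  assumes s: "norm_conv V s a"
  shows norm_conv_add: "norm_conv V t b \<Longrightarrow> norm_conv V (\<lambda>n. s n \<oplus> t n) (a \<oplus> b)"
    and norm_conv_smult: "norm_conv V (\<lambda>n. c \<odot> s n) (c \<odot> a)"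
    and norm_conv_norm: "(\<lambda>n. vnorm V (s n)) \<longlonglongrightarrow> vnorm V a"
proof -
  have sa [simp]: "s n \<in> carrier V" "a \<in> carrier V" for n using s by (auto simp: norm_conv_def)
  have s0: "(\<lambda>n. vnorm V (s n \<ominus> a)) \<longlonglongrightarrow> 0" using s by (simp add: norm_conv_def)
  show "norm_conv V (\<lambda>n. s n \<oplus> t n) (a \<oplus> b)" if t: "norm_conv V t b"
  proof -
    have tb [simp]: "t n \<in> carrier V" "b \<in> carrier V" for n using t by (auto simp: norm_conv_def)
    have t0: "(\<lambda>n. vnorm V (t n \<ominus> b)) \<longlonglongrightarrow> 0" using t by (simp add: norm_conv_def)
    have "(\<lambda>n. vnorm V ((s n \<oplus> t n) \<ominus> (a \<oplus> b))) \<longlonglongrightarrow> 0"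
      by (rule tendsto_sandwich[OF _ _ tendsto_const tendsto_add_zero[OF s0 t0]])
        (simp_all add: add_diff_add seminorm_nonneg seminorm_triangle)
    then show ?thesis by (auto simp: norm_conv_def)
  qed
  show "norm_conv V (\<lambda>n. c \<odot> s n) (c \<odot> a)"
    using tendsto_mult_right_zero[OF s0, of "norm c"]
    by (auto simp: norm_conv_def seminorm_smult simp flip: scale_diff)
  have "(\<lambda>n. vnorm V (s n) - vnorm V a) \<longlonglongrightarrow> 0"
    by (rule Lim_null_comparison[OF always_eventually s0]) (use seminorm_diff_ge in simp)
  then show "(\<lambda>n. vnorm V (s n)) \<longlonglongrightarrow> vnorm V a" by (simp add: LIM_zero_iff)
qed

text \<open>A bounded operator maps Cauchy sequences to Cauchy sequences, which converge in the
  Banach space \<open>F\<close>. The limit depends only on the class, and the bound passes to the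
  limit with the same \<open>C\<close>.\<close>

lemma (in seminormed_space) completion_extension:
  assumes F: "banach_space F" and u: "u \<in> linear_ops V F"
    and bound: "\<And>x. x \<in> carrier V \<Longrightarrow> vnorm F (u x) \<le> C * vnorm V x"
  shows "\<exists>w\<in>linear_ops (completion V) F.
    (\<forall>A\<in>carrier (completion V). vnorm F (w A) \<le> C * vnorm (completion V) A) \<and>
    (\<forall>x\<in>carrier V. w (emb x) = u x)"
proof -
  interpret F: banach_space F by fact
  note [simp] = linear_ops_closed[OF u] linear_ops_add[OF u] linear_ops_smult[OF u]
    linear_ops_diff[OF seminormed_space_axioms F.seminormed_space u]
  have conv: "\<exists>b. norm_conv F (\<lambda>n. u (s n)) b" if s: "s \<in> cauchy_seqs V" for s
  proof (rule F.complete, rule F.cauchy_seqsI)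
    note sc [simp] = cauchy_seqs_closed[OF s]
    show "u (s n) \<in> carrier F" for n by simp
    fix e :: real assume "e > 0"
    then have "e / (\<bar>C\<bar> + 1) > 0" by simp
    then obtain N where N: "\<And>m n. m \<ge> N \<Longrightarrow> n \<ge> N \<Longrightarrow> vnorm V (s m \<ominus> s n) < e / (\<bar>C\<bar> + 1)"
      using cauchy_seqsD[OF s] by blast
    have "vnorm F (u (s m) \<ominus>\<^bsub>F\<^esub> u (s n)) < e" if "m \<ge> N" "n \<ge> N" for m n
    proof -
      have "vnorm F (u (s m) \<ominus>\<^bsub>F\<^esub> u (s n)) \<le> C * vnorm V (s m \<ominus> s n)"
        using bound[of "s m \<ominus> s n"] by simp
      also have "\<dots> \<le> (\<bar>C\<bar> + 1) * vnorm V (s m \<ominus> s n)"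
        by (intro mult_right_mono seminorm_nonneg) auto
      also have "\<dots> < e" using N[OF that] by (simp add: pos_less_divide_eq mult.commute)
      finally show ?thesis .
    qed
    then show "\<exists>N. \<forall>m\<ge>N. \<forall>n\<ge>N. vnorm F (u (s m) \<ominus>\<^bsub>F\<^esub> u (s n)) < e" by blast
  qed
  have indep: "norm_conv F (\<lambda>n. u (t n)) b" if b: "norm_conv F (\<lambda>n. u (s n)) b" and t: "t \<in> cls s" for s t b
  proof -
    have sc [simp]: "s n \<in> carrier V" and tc [simp]: "t n \<in> carrier V" for n
      using t by (auto simp: in_cls_iff null_rel_iff cauchy_seqs_closed)
    have l: "(\<lambda>n. vnorm V (t n \<ominus> s n)) \<longlonglongrightarrow> 0"
      using t by (simp add: in_cls_iff null_rel_iff seminorm_diff_commute[of "t _"])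
    have bc [simp]: "b \<in> carrier F" and lb: "(\<lambda>n. vnorm F (u (s n) \<ominus>\<^bsub>F\<^esub> b)) \<longlonglongrightarrow> 0"
      using b by (auto simp: norm_conv_def)
    have le: "vnorm F (u (t n) \<ominus>\<^bsub>F\<^esub> b) \<le> C * vnorm V (t n \<ominus> s n) + vnorm F (u (s n) \<ominus>\<^bsub>F\<^esub> b)" for n
      using F.seminorm_diff_triangle[of "u (t n)" "u (s n)" b] bound[of "t n \<ominus> s n"] by simp
    have "(\<lambda>n. vnorm F (u (t n) \<ominus>\<^bsub>F\<^esub> b)) \<longlonglongrightarrow> 0"
      by (rule tendsto_sandwich[OF _ _ tendsto_const tendsto_add_zero[OF tendsto_mult_right_zero[OF l, of C] lb]])
        (simp_all add: F.vnorm_nonneg le)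
    then show ?thesis by (auto simp: norm_conv_def)
  qed
  \<comment> \<open>The common limit along all representatives of \<open>A\<close>:
    \<open>conv\<close> gives existence, \<open>indep\<close> independence of the
    representative.\<close>
  define w where "w = (\<lambda>A\<in>carrier (completion V). THE b. \<forall>s\<in>A. norm_conv F (\<lambda>n. u (s n)) b)"
  have w: "w (cls s) = b" if s: "s \<in> cauchy_seqs V" and b: "norm_conv F (\<lambda>n. u (s n)) b" for s b
  proof -
    have "(THE b. \<forall>t\<in>cls s. norm_conv F (\<lambda>n. u (t n)) b) = b"
    proof (rule the_equality)
      show "\<forall>t\<in>cls s. norm_conv F (\<lambda>n. u (t n)) b" using indep[OF b] by blast
      show "a = b" if "\<forall>t\<in>cls s. norm_conv F (\<lambda>n. u (t n)) a" for a
        using that cls_self[OF s] F.norm_conv_unique[OF _ b] by blast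
    qed
    then show ?thesis using s by (simp add: w_def cls_closed)
  qed
  show ?thesis
  proof (intro bexI conjI ballI)
    show "w \<in> linear_ops (completion V) F"
    proof (rule linear_opsI)
      show "w \<in> carrier (completion V) \<rightarrow>\<^sub>E carrier F"
      proof (rule PiE_I)
        fix A assume "A \<in> carrier (completion V)"
        then obtain s where s: "s \<in> cauchy_seqs V" "A = cls s" by (auto simp: carrier_completion)
        obtain b where b: "norm_conv F (\<lambda>n. u (s n)) b" using conv[OF s(1)] by blast
        then show "w A \<in> carrier F" using w[OF s(1) b] by (simp add: s(2) norm_conv_def)
      qed (simp add: w_def)
    next
      fix A B assume "A \<in> carrier (completion V)" "B \<in> carrier (completion V)"
      then obtain s t where s: "s \<in> cauchy_seqs V" "A = cls s" and t: "t \<in> cauchy_seqs V" "B = cls t"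
        by (auto simp: carrier_completion)
      obtain a b where a: "norm_conv F (\<lambda>n. u (s n)) a" and b: "norm_conv F (\<lambda>n. u (t n)) b"
        using conv[OF s(1)] conv[OF t(1)] by blast
      have "norm_conv F (\<lambda>n. u (s n \<oplus> t n)) (a \<oplus>\<^bsub>F\<^esub> b)"
        using F.norm_conv_add[OF a b] by (simp add: cauchy_seqs_closed[OF s(1)] cauchy_seqs_closed[OF t(1)])
      from w[OF cauchy_seqs_add[OF s(1) t(1)] this]
      show "w (A \<oplus>\<^bsub>completion V\<^esub> B) = w A \<oplus>\<^bsub>F\<^esub> w B"
        by (simp add: s(2) t(2) add_completion[OF s(1) t(1)] w[OF s(1) a] w[OF t(1) b])
    next
      fix c A assume "A \<in> carrier (completion V)"
      then obtain s where s: "s \<in> cauchy_seqs V" "A = cls s" by (auto simp: carrier_completion)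
      obtain a where a: "norm_conv F (\<lambda>n. u (s n)) a"
        using conv[OF s(1)] by blast
      have "norm_conv F (\<lambda>n. u (c \<odot> s n)) (c \<odot>\<^bsub>F\<^esub> a)"
        using F.norm_conv_smult[OF a] by (simp add: cauchy_seqs_closed[OF s(1)])
      from w[OF cauchy_seqs_smult[OF s(1)] this]
      show "w (c \<odot>\<^bsub>completion V\<^esub> A) = c \<odot>\<^bsub>F\<^esub> w A"
        by (simp add: s(2) smult_completion[OF s(1)] w[OF s(1) a])
    qed
    fix A assume "A \<in> carrier (completion V)"
    then obtain s where s: "s \<in> cauchy_seqs V" "A = cls s" by (auto simp: carrier_completion)
    obtain a where a: "norm_conv F (\<lambda>n. u (s n)) a"
      using conv[OF s(1)] by blast
    show "vnorm F (w A) \<le> C * vnorm (completion V) A"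
      unfolding s(2) w[OF s(1) a]
      by (rule LIMSEQ_le[OF F.norm_conv_norm[OF a] tendsto_mult_left[OF norm_completion[OF s(1)]]])
        (auto intro!: exI[of _ 0] bound simp: cauchy_seqs_closed[OF s(1)])
  next
    fix x assume x: "x \<in> carrier V"
    show "w (emb x) = u x"
      unfolding emb_def by (rule w) (use x in \<open>simp_all add: cauchy_seqs_const norm_conv_def\<close>)
  qed
qed

section \<open>The projective tensor product\<close>

lemma lookup_fscale [simp]: "Poly_Mapping.lookup (fscale t c) x = t * Poly_Mapping.lookup c x"
  by (simp add: fscale_def Poly_Mapping.map.rep_eq when_def)

interpretation fscale: Modules.module "fscale :: 'k::real_normed_field \<Rightarrow> ('x \<Rightarrow>\<^sub>0 'k) \<Rightarrow> _"
  by unfold_locales (simp_all add: poly_mapping_eq_iff fun_eq_iff lookup_add algebra_simps)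

lemma keys_fscale: "Poly_Mapping.keys (fscale t c) \<subseteq> Poly_Mapping.keys c"
  by (auto simp: in_keys_iff)

text \<open>The free vector space on the tuples, inside the finitely supported functions on the
  whole type.\<close>

definition formal_tensors :: "('i::finite \<Rightarrow> ('k::real_normed_field, 'e) nspace) \<Rightarrow> (('i \<Rightarrow> 'e) \<Rightarrow>\<^sub>0 'k) set" where
  "formal_tensors E = {c. Poly_Mapping.keys c \<subseteq> tuples E}"

lemma subspace_formal_tensors: "fscale.subspace (formal_tensors E)"
proof (rule fscale.subspaceI)
  show "c + d \<in> formal_tensors E" if "c \<in> formal_tensors E" "d \<in> formal_tensors E" for c d
    using that keys_add[of c d] by (auto simp: formal_tensors_def)
  show "fscale t c \<in> formal_tensors E" if "c \<in> formal_tensors E" for t c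
    using that keys_fscale[of t c] by (auto simp: formal_tensors_def)
qed (simp add: formal_tensors_def)

lemma single_in_formal_tensors [simp]: "x \<in> tuples E \<Longrightarrow> Poly_Mapping.single x 1 \<in> formal_tensors E"
  by (simp add: formal_tensors_def)

text \<open>The cost of one representation. The projective seminorm is the infimum of these costs
  over a coset.\<close>

definition formal_norm :: "('i::finite \<Rightarrow> ('k::real_normed_field, 'e) nspace) \<Rightarrow> (('i \<Rightarrow> 'e) \<Rightarrow>\<^sub>0 'k) \<Rightarrow> real" where
  "formal_norm E c = (\<Sum>x\<in>Poly_Mapping.keys c. norm (Poly_Mapping.lookup c x) * (\<Prod>i\<in>UNIV. vnorm (E i) (x i)))"

lemma subspace_tensor_relations: "fscale.subspace (tensor_relations E)"
  unfolding tensor_relations_def by (rule fscale.subspace_span)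

lemmas tensor_relations_zero = fscale.subspace_0[OF subspace_tensor_relations]
  and tensor_relations_add = fscale.subspace_add[OF subspace_tensor_relations]
  and tensor_relations_diff = fscale.subspace_diff[OF subspace_tensor_relations]
  and tensor_relations_scale = fscale.subspace_scale[OF subspace_tensor_relations]

section \<open>Arithmetic of cosets modulo the multilinearity relations\<close>

lemma in_coset_iff: "d \<in> c +o tensor_relations E \<longleftrightarrow> d - c \<in> tensor_relations E"
proof
  show "d - c \<in> tensor_relations E" if "d \<in> c +o tensor_relations E"
    using that by (auto simp: elt_set_plus_def)
  show "d \<in> c +o tensor_relations E" if "d - c \<in> tensor_relations E"
    using set_plus_intro2[OF that, of c] by simp
qed

lemma coset_eq_iff: "c +o tensor_relations E = d +o tensor_relations E \<longleftrightarrow> c - d \<in> tensor_relations E"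
proof
  assume "c +o tensor_relations E = d +o tensor_relations E"
  moreover have "c \<in> c +o tensor_relations E" by (simp add: in_coset_iff tensor_relations_zero)
  ultimately show "c - d \<in> tensor_relations E" by (simp add: in_coset_iff)
next
  assume cd: "c - d \<in> tensor_relations E"
  have "b - c \<in> tensor_relations E \<longleftrightarrow> b - d \<in> tensor_relations E" for b
    using tensor_relations_add[OF _ cd, of "b - c"] tensor_relations_diff[OF _ cd, of "b - d"] by auto
  then show "c +o tensor_relations E = d +o tensor_relations E" by (auto simp: in_coset_iff)
qed

lemma coset_add:
  "(c +o tensor_relations E) + (d +o tensor_relations E) = (c + d) +o tensor_relations E"
proof -
  have "tensor_relations E + tensor_relations E = tensor_relations E"
  proof
    show "tensor_relations E + tensor_relations E \<subseteq> tensor_relations E"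
      using tensor_relations_add by (auto elim!: set_plus_elim)
    show "tensor_relations E \<subseteq> tensor_relations E + tensor_relations E"
      by (rule set_zero_plus2[OF tensor_relations_zero])
  qed
  then show ?thesis by (simp add: set_plus_rearrange)
qed

text \<open>For \<open>t = 0\<close> the image of a coset is only the singleton of zero. Adding the
  subspace enlarges it to the zero coset, so that one formula covers all scalars.\<close>

lemma coset_scale:
  "fscale t ` (c +o tensor_relations E) + tensor_relations E = fscale t c +o tensor_relations E"
proof -
  have "d \<in> fscale t ` (c +o tensor_relations E) + tensor_relations E \<longleftrightarrow> d \<in> fscale t c +o tensor_relations E" for d
  proof
    assume "d \<in> fscale t ` (c +o tensor_relations E) + tensor_relations E"
    then obtain b r where b: "b - c \<in> tensor_relations E" "r \<in> tensor_relations E" "d = fscale t b + r"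
      by (auto simp: set_plus_def in_coset_iff)
    have "d - fscale t c = fscale t (b - c) + r" by (simp add: b(3) fscale.scale_right_diff_distrib)
    also have "\<dots> \<in> tensor_relations E" by (intro tensor_relations_add tensor_relations_scale b)
    finally show "d \<in> fscale t c +o tensor_relations E" by (simp only: in_coset_iff)
  next
    assume "d \<in> fscale t c +o tensor_relations E"
    then have d: "d - fscale t c \<in> tensor_relations E" by (simp add: in_coset_iff)
    have "fscale t c \<in> fscale t ` (c +o tensor_relations E)"
      by (simp add: in_coset_iff tensor_relations_zero)
    from set_plus_intro[OF this d]
    show "d \<in> fscale t ` (c +o tensor_relations E) + tensor_relations E" by simp
  qed
  then show ?thesis by blast
qed

lemma
  shows carrier_alg_tensor: "carrier (alg_tensor E) = (\<lambda>c. c +o tensor_relations E) ` formal_tensors E"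
    and zero_alg_tensor: "\<zero>\<^bsub>alg_tensor E\<^esub> = 0 +o tensor_relations E"
    and add_alg_tensor: "(c +o tensor_relations E) \<oplus>\<^bsub>alg_tensor E\<^esub> (d +o tensor_relations E) =
      (c + d) +o tensor_relations E"
    and smult_alg_tensor: "t \<odot>\<^bsub>alg_tensor E\<^esub> (c +o tensor_relations E) = fscale t c +o tensor_relations E"
    and norm_alg_tensor: "vnorm (alg_tensor E) A = (INF c\<in>A \<inter> formal_tensors E. formal_norm E c)"
proof -
  show "carrier (alg_tensor E) = (\<lambda>c. c +o tensor_relations E) ` formal_tensors E"
    unfolding alg_tensor_def formal_tensors_def partial_object.simps by blast
  show "\<zero>\<^bsub>alg_tensor E\<^esub> = 0 +o tensor_relations E"
    by (simp add: alg_tensor_def)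
  show "(c +o tensor_relations E) \<oplus>\<^bsub>alg_tensor E\<^esub> (d +o tensor_relations E) = (c + d) +o tensor_relations E"
    using coset_add[of c E d] by (simp only: alg_tensor_def ring.simps)
  show "t \<odot>\<^bsub>alg_tensor E\<^esub> (c +o tensor_relations E) = fscale t c +o tensor_relations E"
    using coset_scale[of t c E] by (simp only: alg_tensor_def module.simps)
  have "{c \<in> A. Poly_Mapping.keys c \<subseteq> tuples E} = A \<inter> formal_tensors E"
    by (auto simp: formal_tensors_def)
  then show "vnorm (alg_tensor E) A = (INF c\<in>A \<inter> formal_tensors E. formal_norm E c)"
    by (simp only: alg_tensor_def nspace.simps formal_norm_def)
qed

lemmas alg_tensor_simps = carrier_alg_tensor zero_alg_tensor add_alg_tensor smult_alg_tensor

text \<open>The elementary tensor of the tuple \<open>x\<close> in the algebraic tensor product;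
  \<open>pure_tensor\<close> is its image in the completion.\<close>

definition alg_pure ::
    "('i::finite \<Rightarrow> ('k::real_normed_field, 'e) nspace) \<Rightarrow> ('i \<Rightarrow> 'e) \<Rightarrow> (('i \<Rightarrow> 'e) \<Rightarrow>\<^sub>0 'k) set" where
  "alg_pure E x = Poly_Mapping.single x 1 +o tensor_relations E"

definition pure_tensor ::
    "('i::finite \<Rightarrow> ('k::real_normed_field, 'e) nspace) \<Rightarrow> ('i \<Rightarrow> 'e) \<Rightarrow> ('i, 'e, 'k) ptensor" where
  "pure_tensor E x = seminormed_space.emb (alg_tensor E) (alg_pure E x)"

context
  fixes E :: "'i::finite \<Rightarrow> ('k::real_normed_field, 'e) nspace"
  assumes E: "\<And>i. normed_space (E i)"
begin

interpretation E: normed_space "E i" for i by (rule E)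

text \<open>Coefficients can cancel in a sum or vanish under scaling, so supports differ. Summing
  over a common superset makes costs comparable term by term.\<close>

lemma formal_norm_superset:
  assumes "finite K" "Poly_Mapping.keys c \<subseteq> K"
  shows "formal_norm E c = (\<Sum>x\<in>K. norm (Poly_Mapping.lookup c x) * (\<Prod>i\<in>UNIV. vnorm (E i) (x i)))"
  unfolding formal_norm_def by (rule sum.mono_neutral_left) (use assms in \<open>auto simp: in_keys_iff\<close>)

lemma tuples_prod_nonneg: "x \<in> tuples E \<Longrightarrow> 0 \<le> (\<Prod>i\<in>UNIV. vnorm (E i) (x i))"
  by (intro prod_nonneg) (simp add: tuples_iff E.vnorm_nonneg)

lemma formal_norm_nonneg: "c \<in> formal_tensors E \<Longrightarrow> 0 \<le> formal_norm E c"
  unfolding formal_norm_def formal_tensors_def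
  by (intro sum_nonneg mult_nonneg_nonneg tuples_prod_nonneg) auto

lemma formal_norm_add:
  assumes "c \<in> formal_tensors E" "d \<in> formal_tensors E"
  shows "formal_norm E (c + d) \<le> formal_norm E c + formal_norm E d"
proof -
  define K where "K = Poly_Mapping.keys c \<union> Poly_Mapping.keys d"
  have K: "finite K" "Poly_Mapping.keys c \<subseteq> K" "Poly_Mapping.keys d \<subseteq> K" "Poly_Mapping.keys (c + d) \<subseteq> K"
    using keys_add[of c d] by (auto simp: K_def)
  have "norm (Poly_Mapping.lookup (c + d) x) * (\<Prod>i\<in>UNIV. vnorm (E i) (x i)) \<le>
      norm (Poly_Mapping.lookup c x) * (\<Prod>i\<in>UNIV. vnorm (E i) (x i)) +
      norm (Poly_Mapping.lookup d x) * (\<Prod>i\<in>UNIV. vnorm (E i) (x i))" if "x \<in> K" for x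
  proof -
    have "x \<in> tuples E" using that assms by (auto simp: K_def formal_tensors_def)
    from mult_right_mono[OF norm_triangle_ineq[of "Poly_Mapping.lookup c x" "Poly_Mapping.lookup d x"] tuples_prod_nonneg[OF this]]
    show ?thesis by (simp add: lookup_add distrib_right)
  qed
  then show ?thesis
    unfolding formal_norm_superset[OF K(1,2)] formal_norm_superset[OF K(1,3)] formal_norm_superset[OF K(1,4)]
    by (simp only: sum_mono flip: sum.distrib)
qed

lemma formal_norm_fscale: "formal_norm E (fscale t c) = norm t * formal_norm E c"
  using formal_norm_superset[OF finite_keys keys_fscale[of t c]]
  by (simp add: formal_norm_def sum_distrib_left norm_mult mult.assoc)

lemma formal_norm_single [simp]: "formal_norm E (Poly_Mapping.single x 1) = (\<Prod>i\<in>UNIV. vnorm (E i) (x i))"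
  by (simp add: formal_norm_def)

lemma tensor_norm_bdd_below: "bdd_below (formal_norm E ` (A \<inter> formal_tensors E))"
  by (rule bdd_belowI2[of _ 0]) (auto intro: formal_norm_nonneg)

lemma tensor_norm_le: "c \<in> A \<Longrightarrow> c \<in> formal_tensors E \<Longrightarrow> vnorm (alg_tensor E) A \<le> formal_norm E c"
  unfolding norm_alg_tensor by (rule cINF_lower[OF tensor_norm_bdd_below]) auto

lemma representative_in_coset: "c \<in> formal_tensors E \<Longrightarrow> c \<in> (c +o tensor_relations E) \<inter> formal_tensors E"
  by (simp add: in_coset_iff tensor_relations_zero)

lemma tensor_norm_greatest:
  assumes "A \<in> carrier (alg_tensor E)"
    and "\<And>c. c \<in> A \<Longrightarrow> c \<in> formal_tensors E \<Longrightarrow> r \<le> formal_norm E c"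
  shows "r \<le> vnorm (alg_tensor E) A"
  unfolding norm_alg_tensor
proof (rule cINF_greatest)
  show "A \<inter> formal_tensors E \<noteq> {}" using assms(1) representative_in_coset by (auto simp: alg_tensor_simps)
qed (use assms in auto)

lemma formal_tensors_closed:
  "0 \<in> formal_tensors E"
  "c \<in> formal_tensors E \<Longrightarrow> d \<in> formal_tensors E \<Longrightarrow> c + d \<in> formal_tensors E"
  "c \<in> formal_tensors E \<Longrightarrow> fscale t c \<in> formal_tensors E"
  using subspace_formal_tensors[of E] by (auto simp: fscale.subspace_def)

text \<open>Each inequality is proved for single representations and then passed to the infimum.
  Homogeneity follows from its upper half, applied once more with the inverse scalar.\<close>

lemma seminormed_space_alg_tensor: "seminormed_space (alg_tensor E)"
proof (intro seminormed_space.intro seminormed_space_axioms.intro)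
  show "Module.module scalars (alg_tensor E)"
    by (rule module_scalarsI)
      (auto simp: alg_tensor_simps formal_tensors_closed add_ac fscale.scale_left_distrib
        fscale.scale_right_distrib simp del: set_zero_plus intro!: imageI)
  fix A assume A: "A \<in> carrier (alg_tensor E)"
  then obtain a where a: "a \<in> formal_tensors E" "A = a +o tensor_relations E" by (auto simp: alg_tensor_simps)
  show "0 \<le> vnorm (alg_tensor E) A"
    by (rule tensor_norm_greatest[OF A]) (rule formal_norm_nonneg)
  have smult_le: "vnorm (alg_tensor E) (t \<odot>\<^bsub>alg_tensor E\<^esub> A) \<le> norm t * formal_norm E c"
    if A: "A \<in> carrier (alg_tensor E)" and c: "c \<in> A" "c \<in> formal_tensors E" for t A c
  proof -
    obtain a where a: "a \<in> formal_tensors E" "A = a +o tensor_relations E"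
      using A by (auto simp: alg_tensor_simps)
    have "fscale t c - fscale t a \<in> tensor_relations E"
      using c(1) tensor_relations_scale by (simp add: a in_coset_iff flip: fscale.scale_right_diff_distrib)
    then have "fscale t c \<in> t \<odot>\<^bsub>alg_tensor E\<^esub> A"
      by (simp add: a alg_tensor_simps in_coset_iff)
    from tensor_norm_le[OF this formal_tensors_closed(3)[OF c(2)]] show ?thesis
      by (simp add: formal_norm_fscale)
  qed
  have closed: "t \<odot>\<^bsub>alg_tensor E\<^esub> A \<in> carrier (alg_tensor E)" for t
    using a by (auto simp: alg_tensor_simps formal_tensors_closed)
  have norm_smult_le: "vnorm (alg_tensor E) (t \<odot>\<^bsub>alg_tensor E\<^esub> A) \<le> norm t * vnorm (alg_tensor E) A"
    if A: "A \<in> carrier (alg_tensor E)" and t: "t \<noteq> 0" for t A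
  proof -
    have "vnorm (alg_tensor E) (t \<odot>\<^bsub>alg_tensor E\<^esub> A) / norm t \<le> vnorm (alg_tensor E) A"
      by (rule tensor_norm_greatest[OF A])
        (use smult_le[OF A] t in \<open>simp add: divide_le_eq mult.commute\<close>)
    then show ?thesis using t by (simp add: divide_le_eq mult.commute)
  qed
  \<comment> \<open>The infimum argument divides by \<open>norm t\<close>, so \<open>t = 0\<close>
    is treated on its own through one representation.\<close>
  show "vnorm (alg_tensor E) (t \<odot>\<^bsub>alg_tensor E\<^esub> A) = norm t * vnorm (alg_tensor E) A" for t
  proof (cases "t = 0")
    case True
    have "vnorm (alg_tensor E) (t \<odot>\<^bsub>alg_tensor E\<^esub> A) \<le> 0"
      using smult_le[OF A, of a t] a True representative_in_coset[of a] by simp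
    moreover have "0 \<le> vnorm (alg_tensor E) (t \<odot>\<^bsub>alg_tensor E\<^esub> A)"
      by (rule tensor_norm_greatest[OF closed]) (rule formal_norm_nonneg)
    ultimately show ?thesis using True by simp
  next
    case False
    have "inverse t \<odot>\<^bsub>alg_tensor E\<^esub> (t \<odot>\<^bsub>alg_tensor E\<^esub> A) = A"
      using False by (simp add: a alg_tensor_simps)
    then have "vnorm (alg_tensor E) A \<le> norm (inverse t) * vnorm (alg_tensor E) (t \<odot>\<^bsub>alg_tensor E\<^esub> A)"
      using norm_smult_le[OF closed[of t], of "inverse t"] False by simp
    then have "norm t * vnorm (alg_tensor E) A \<le> vnorm (alg_tensor E) (t \<odot>\<^bsub>alg_tensor E\<^esub> A)"
      using False by (simp add: norm_inverse norm_divide field_simps)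
    then show ?thesis using norm_smult_le[OF A False] by simp
  qed
  fix B assume B: "B \<in> carrier (alg_tensor E)"
  then obtain b where b: "b \<in> formal_tensors E" "B = b +o tensor_relations E" by (auto simp: alg_tensor_simps)
  have triangle: "vnorm (alg_tensor E) (A \<oplus>\<^bsub>alg_tensor E\<^esub> B) \<le> formal_norm E c + formal_norm E d"
    if c: "c \<in> A" "c \<in> formal_tensors E" and d: "d \<in> B" "d \<in> formal_tensors E" for c d
  proof -
    have "(c - a) + (d - b) \<in> tensor_relations E"
      using c(1) d(1) by (intro tensor_relations_add) (simp_all add: a b in_coset_iff)
    then have "c + d \<in> A \<oplus>\<^bsub>alg_tensor E\<^esub> B"
      by (simp add: a b alg_tensor_simps in_coset_iff algebra_simps)
    from tensor_norm_le[OF this formal_tensors_closed(2)[OF c(2) d(2)]] formal_norm_add[OF c(2) d(2)]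
    show ?thesis by simp
  qed
  \<comment> \<open>The two infima are taken one after the other: over representations of
    \<open>B\<close> with \<open>c\<close> fixed, then over \<open>c\<close>.\<close>
  have "vnorm (alg_tensor E) (A \<oplus>\<^bsub>alg_tensor E\<^esub> B) - formal_norm E c \<le> vnorm (alg_tensor E) B"
    if "c \<in> A" "c \<in> formal_tensors E" for c
    by (rule tensor_norm_greatest[OF B]) (use triangle[OF that] in \<open>simp add: diff_le_eq add.commute\<close>)
  then have "vnorm (alg_tensor E) (A \<oplus>\<^bsub>alg_tensor E\<^esub> B) - vnorm (alg_tensor E) B \<le> vnorm (alg_tensor E) A"
    by (intro tensor_norm_greatest[OF A]) (simp add: diff_le_eq add.commute)
  then show "vnorm (alg_tensor E) (A \<oplus>\<^bsub>alg_tensor E\<^esub> B) \<le> vnorm (alg_tensor E) A + vnorm (alg_tensor E) B"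
    by simp
qed

interpretation alg: seminormed_space "alg_tensor E"
  by (rule seminormed_space_alg_tensor)

lemma banach_space_proj_tensor: "banach_space (proj_tensor E)"
  unfolding proj_tensor_def by (rule alg.banach_space_completion)

lemma alg_pure_closed [simp]: "x \<in> tuples E \<Longrightarrow> alg_pure E x \<in> carrier (alg_tensor E)"
  by (auto simp: alg_pure_def alg_tensor_simps)

lemma
  assumes x: "x \<in> tuples E" and a: "a \<in> carrier (E i)"
  shows alg_pure_add: "b \<in> carrier (E i) \<Longrightarrow>
      alg_pure E (x(i := a \<oplus>\<^bsub>E i\<^esub> b)) = alg_pure E (x(i := a)) \<oplus>\<^bsub>alg_tensor E\<^esub> alg_pure E (x(i := b))"
    and alg_pure_smult: "alg_pure E (x(i := t \<odot>\<^bsub>E i\<^esub> a)) = t \<odot>\<^bsub>alg_tensor E\<^esub> alg_pure E (x(i := a))"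
proof -
  show "alg_pure E (x(i := a \<oplus>\<^bsub>E i\<^esub> b)) = alg_pure E (x(i := a)) \<oplus>\<^bsub>alg_tensor E\<^esub> alg_pure E (x(i := b))"
    if b: "b \<in> carrier (E i)"
    \<comment> \<open>Reassociating the difference gives it literally the shape of a generator of
      \<open>tensor_relations\<close>.\<close>
    unfolding alg_pure_def alg_tensor_simps coset_eq_iff diff_diff_eq[symmetric]
    unfolding tensor_relations_def by (rule fscale.span_base) (use x a b in blast)
  show "alg_pure E (x(i := t \<odot>\<^bsub>E i\<^esub> a)) = t \<odot>\<^bsub>alg_tensor E\<^esub> alg_pure E (x(i := a))"
    unfolding alg_pure_def alg_tensor_simps coset_eq_iff
    unfolding tensor_relations_def by (rule fscale.span_base) (use x a in blast)
qed

text \<open>The norm estimate comes from the one-term representation of an elementary tensor; with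
  additivity and homogeneity in each slot it makes the canonical map a bounded multilinear operator
  of constant 1.\<close>

lemma
  assumes x: "x \<in> tuples E"
  shows pure_tensor_closed [simp]: "pure_tensor E x \<in> carrier (proj_tensor E)"
    and norm_pure_tensor: "vnorm (proj_tensor E) (pure_tensor E x) \<le> (\<Prod>i\<in>UNIV. vnorm (E i) (x i))"
    and pure_tensor_add: "a \<in> carrier (E i) \<Longrightarrow> b \<in> carrier (E i) \<Longrightarrow>
      pure_tensor E (x(i := a \<oplus>\<^bsub>E i\<^esub> b)) = pure_tensor E (x(i := a)) \<oplus>\<^bsub>proj_tensor E\<^esub> pure_tensor E (x(i := b))"
    and pure_tensor_smult: "a \<in> carrier (E i) \<Longrightarrow>
      pure_tensor E (x(i := t \<odot>\<^bsub>E i\<^esub> a)) = t \<odot>\<^bsub>proj_tensor E\<^esub> pure_tensor E (x(i := a))"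
proof -
  have "vnorm (alg_tensor E) (alg_pure E x) \<le> formal_norm E (Poly_Mapping.single x 1)"
    unfolding alg_pure_def using representative_in_coset[of "Poly_Mapping.single x 1"] x
    by (intro tensor_norm_le) auto
  then show "vnorm (proj_tensor E) (pure_tensor E x) \<le> (\<Prod>i\<in>UNIV. vnorm (E i) (x i))"
    using x by (simp add: pure_tensor_def proj_tensor_def)
qed (use x in \<open>simp_all add: pure_tensor_def proj_tensor_def alg.emb_closed tuples_upd
    alg_pure_add alg_pure_smult alg.emb_add alg.emb_smult\<close>)

text \<open>Universal property: the linear extension \<open>L\<close> of \<open>T\<close> to formal
  sums kills the generating relations because \<open>T\<close> is multilinear, so it is constant on
  cosets. Its bound holds for every representation and hence for the infimum.\<close>

lemma alg_tensor_linearization: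
  assumes F: "normed_space F" and T: "multilinear E F T"
    and C: "C > 0" "\<And>x. x \<in> tuples E \<Longrightarrow> vnorm F (T x) \<le> C * (\<Prod>i\<in>UNIV. vnorm (E i) (x i))"
  shows "\<exists>u\<in>linear_ops (alg_tensor E) F. (\<forall>A\<in>carrier (alg_tensor E). vnorm F (u A) \<le> C * vnorm (alg_tensor E) A) \<and>
    (\<forall>x\<in>tuples E. u (alg_pure E x) = T x)"
proof -
  interpret F: normed_space F by fact
  note Tc [simp] = multilinear_closed[OF E F T]
  \<comment> \<open>Extension by zero off the tuples makes \<open>L\<close> linear on all finitely
    supported functions, without conditions on supports.\<close>
  define T' where "T' x = (if x \<in> tuples E then T x else \<zero>\<^bsub>F\<^esub>)" for x
  have [simp]: "T' x \<in> carrier F" for x by (simp add: T'_def)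
  define L where "L c = (\<Oplus>\<^bsub>F\<^esub>x\<in>Poly_Mapping.keys c. Poly_Mapping.lookup c x \<odot>\<^bsub>F\<^esub> T' x)" for c
  have Lc [simp]: "L c \<in> carrier F" for c
    unfolding L_def by (rule F.M.finsum_closed) auto
  have L_superset: "L c = (\<Oplus>\<^bsub>F\<^esub>x\<in>K. Poly_Mapping.lookup c x \<odot>\<^bsub>F\<^esub> T' x)"
    if "finite K" "Poly_Mapping.keys c \<subseteq> K" for c K
    unfolding L_def by (rule F.M.add.finprod_mono_neutral_cong_left) (use that in \<open>auto simp: in_keys_iff\<close>)
  have L_add: "L (c + d) = L c \<oplus>\<^bsub>F\<^esub> L d" for c d
  proof -
    define K where "K = Poly_Mapping.keys c \<union> Poly_Mapping.keys d"
    have K: "finite K" "Poly_Mapping.keys c \<subseteq> K" "Poly_Mapping.keys d \<subseteq> K" "Poly_Mapping.keys (c + d) \<subseteq> K"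
      using keys_add[of c d] by (auto simp: K_def)
    show ?thesis
      by (simp add: L_superset[OF K(1)] K lookup_add F.scale_add_left F.M.finsum_addf Pi_def)
  qed
  have L_scale: "L (fscale t c) = t \<odot>\<^bsub>F\<^esub> L c" for t c
  proof -
    have "t \<odot>\<^bsub>F\<^esub> L c = (\<Oplus>\<^bsub>F\<^esub>x\<in>Poly_Mapping.keys c. t \<odot>\<^bsub>F\<^esub> (Poly_Mapping.lookup c x \<odot>\<^bsub>F\<^esub> T' x))"
      unfolding L_def by (rule F.finsum_smult_ldistr) auto
    then show ?thesis
      by (simp add: L_superset[OF finite_keys keys_fscale] F.scale_scale)
  qed
  have L_diff: "L (c - d) = L c \<ominus>\<^bsub>F\<^esub> L d" for c d
    using L_add[of c "fscale (- 1) d"] L_scale[of "- 1" d] by (simp add: F.diff_scale)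
  have L_single: "L (Poly_Mapping.single x 1) = T' x" for x
    unfolding L_def by simp
  have "tensor_relations E \<subseteq> {c. L c = \<zero>\<^bsub>F\<^esub>}"
    unfolding tensor_relations_def
  proof (rule fscale.span_minimal)
    show "fscale.subspace {c. L c = \<zero>\<^bsub>F\<^esub>}"
      unfolding fscale.subspace_def by (auto simp: L_add L_scale) (simp add: L_def)
  qed (auto simp: L_diff L_scale L_single T'_def tuples_upd multilinear_add[OF E F T] multilinear_smult[OF E F T]
      F.add_diff_cancel_left)
  then have L_cong: "L d = L c" if "d \<in> c +o tensor_relations E" for c d
    using that L_diff[of d c] F.diff_eq_zero_iff[of "L d" "L c"] by (auto simp: in_coset_iff)
  have L_norm: "vnorm F (L c) \<le> C * formal_norm E c" if c: "c \<in> formal_tensors E" for c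
  proof -
    \<comment> \<open>The index set is detached from \<open>c\<close>, so that the induction can
      enlarge it while the coefficients stay fixed.\<close>
    have "vnorm F (\<Oplus>\<^bsub>F\<^esub>x\<in>K. Poly_Mapping.lookup c x \<odot>\<^bsub>F\<^esub> T' x) \<le>
        (\<Sum>x\<in>K. C * (norm (Poly_Mapping.lookup c x) * (\<Prod>i\<in>UNIV. vnorm (E i) (x i))))"
      if "finite K" "K \<subseteq> tuples E" for K
      using that
    proof (induction K rule: finite_induct)
      case (insert y K)
      have "vnorm F (Poly_Mapping.lookup c y \<odot>\<^bsub>F\<^esub> T' y) \<le>
          C * (norm (Poly_Mapping.lookup c y) * (\<Prod>i\<in>UNIV. vnorm (E i) (y i)))"
        using insert.prems mult_left_mono[OF C(2)[of y], of "norm (Poly_Mapping.lookup c y)"]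
        by (simp add: F.vnorm_smult T'_def algebra_simps)
      moreover have "vnorm F (Poly_Mapping.lookup c y \<odot>\<^bsub>F\<^esub> T' y \<oplus>\<^bsub>F\<^esub> (\<Oplus>\<^bsub>F\<^esub>x\<in>K. Poly_Mapping.lookup c x \<odot>\<^bsub>F\<^esub> T' x)) \<le>
          vnorm F (Poly_Mapping.lookup c y \<odot>\<^bsub>F\<^esub> T' y) + vnorm F (\<Oplus>\<^bsub>F\<^esub>x\<in>K. Poly_Mapping.lookup c x \<odot>\<^bsub>F\<^esub> T' x)"
        by (intro F.vnorm_triangle F.M.finsum_closed) auto
      ultimately show ?case
        using insert by (simp add: Pi_def)
    qed simp
    from this[OF finite_keys] c show ?thesis
      by (simp add: L_def formal_norm_def formal_tensors_def sum_distrib_left)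
  qed
  \<comment> \<open>Any representative may be chosen, since \<open>L_cong\<close> makes
    \<open>L\<close> constant on each coset.\<close>
  define u where "u = (\<lambda>A\<in>carrier (alg_tensor E). L (SOME c. c \<in> A))"
  have u: "u (c +o tensor_relations E) = L c" if "c \<in> formal_tensors E" for c
  proof -
    have "c \<in> c +o tensor_relations E" using representative_in_coset[OF that] by blast
    then have "(SOME d. d \<in> c +o tensor_relations E) \<in> c +o tensor_relations E" by (rule someI)
    then show ?thesis using that L_cong by (auto simp: u_def alg_tensor_simps)
  qed
  show ?thesis
  proof (intro bexI conjI ballI)
    show "u \<in> linear_ops (alg_tensor E) F"
    proof (rule linear_opsI)
      show "u \<in> carrier (alg_tensor E) \<rightarrow>\<^sub>E carrier F" by (auto simp: u_def)
    qed (auto simp: alg_tensor_simps u formal_tensors_closed L_add L_scale)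
    fix A assume A: "A \<in> carrier (alg_tensor E)"
    then obtain a where a: "a \<in> formal_tensors E" "A = a +o tensor_relations E" by (auto simp: alg_tensor_simps)
    \<comment> \<open>Dividing by \<open>C\<close> yields a lower bound for the costs of all
      representations of \<open>A\<close>; hence the assumption that \<open>C\<close> is
      positive.\<close>
    have "vnorm F (u A) / C \<le> vnorm (alg_tensor E) A"
    proof (rule tensor_norm_greatest[OF A])
      fix c assume "c \<in> A" "c \<in> formal_tensors E"
      then show "vnorm F (u A) / C \<le> formal_norm E c"
        using L_cong[of c a] L_norm[of c] C(1) by (simp add: a u divide_le_eq mult.commute)
    qed
    then show "vnorm F (u A) \<le> C * vnorm (alg_tensor E) A"
      using C(1) by (simp add: divide_le_eq mult.commute)
  next
    fix x assume "x \<in> tuples E"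
    then show "u (alg_pure E x) = T x" by (simp add: alg_pure_def u L_single T'_def)
  qed
qed

theorem proj_tensor_linearization:
  assumes F: "banach_space F" and T: "T \<in> multilinear_ops E F"
  shows "\<exists>w C. w \<in> linear_ops (proj_tensor E) F \<and>
    (\<forall>z\<in>carrier (proj_tensor E). vnorm F (w z) \<le> C * vnorm (proj_tensor E) z) \<and>
    (\<forall>x\<in>tuples E. w (pure_tensor E x) = T x)"
proof -
  interpret F: banach_space F by fact
  obtain C where T': "multilinear E F T"
    and C: "\<And>x. x \<in> tuples E \<Longrightarrow> vnorm F (T x) \<le> C * (\<Prod>i\<in>UNIV. vnorm (E i) (x i))"
    using T multilinear_ops_iff[of E F T, OF E F.normed_space_axioms] by blast
  \<comment> \<open>The bound obtained from continuity may have a nonpositive constant, whereas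
    \<open>alg_tensor_linearization\<close> asks for a positive one.\<close>
  have bound: "vnorm F (T x) \<le> (\<bar>C\<bar> + 1) * (\<Prod>i\<in>UNIV. vnorm (E i) (x i))" if "x \<in> tuples E" for x
    by (rule order_trans[OF C[OF that] mult_right_mono]) (use that tuples_prod_nonneg in auto)
  have "\<bar>C\<bar> + 1 > 0" by simp
  from alg_tensor_linearization[OF F.normed_space_axioms T' this bound]
  obtain u where u: "u \<in> linear_ops (alg_tensor E) F"
      "\<And>A. A \<in> carrier (alg_tensor E) \<Longrightarrow> vnorm F (u A) \<le> (\<bar>C\<bar> + 1) * vnorm (alg_tensor E) A"
      "\<And>x. x \<in> tuples E \<Longrightarrow> u (alg_pure E x) = T x"
    by blast
  from alg.completion_extension[OF F u(1,2)] obtain w where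
    "w \<in> linear_ops (proj_tensor E) F"
    "\<And>z. z \<in> carrier (proj_tensor E) \<Longrightarrow> vnorm F (w z) \<le> (\<bar>C\<bar> + 1) * vnorm (proj_tensor E) z"
    "\<And>A. A \<in> carrier (alg_tensor E) \<Longrightarrow> w (alg.emb A) = u A"
    unfolding proj_tensor_def by blast
  then show ?thesis
    using u(3) by (intro exI[of _ w] exI[of _ "\<bar>C\<bar> + 1"]) (simp add: pure_tensor_def)
qed

end

section \<open>Transport of structure and the factorization\<close>

text \<open>An isometric copy on another type, for injective \<open>h\<close>; it places the tensor
  product on the type that \<open>DP_comp_L\<close> prescribes.\<close>

definition transport :: "('v \<Rightarrow> 'w) \<Rightarrow> ('k, 'v) nspace \<Rightarrow> ('k, 'w) nspace" where
  "transport h V = \<lparr>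
     carrier = h ` carrier V,
     mult = undefined, one = undefined,
     zero = h \<zero>\<^bsub>V\<^esub>,
     add = (\<lambda>x y. h (inv_into UNIV h x \<oplus>\<^bsub>V\<^esub> inv_into UNIV h y)),
     smult = (\<lambda>t x. h (t \<odot>\<^bsub>V\<^esub> inv_into UNIV h x)),
     vnorm = (\<lambda>x. vnorm V (inv_into UNIV h x))\<rparr>"

lemma
  assumes "inj h"
  shows carrier_transport: "carrier (transport h V) = h ` carrier V"
    and zero_transport: "\<zero>\<^bsub>transport h V\<^esub> = h \<zero>\<^bsub>V\<^esub>"
    and add_transport: "h x \<oplus>\<^bsub>transport h V\<^esub> h y = h (x \<oplus>\<^bsub>V\<^esub> y)"
    and smult_transport: "t \<odot>\<^bsub>transport h V\<^esub> h x = h (t \<odot>\<^bsub>V\<^esub> x)"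
    and norm_transport: "vnorm (transport h V) (h x) = vnorm V x"
  using assms by (simp_all add: transport_def)

lemmas transport_simps = carrier_transport zero_transport add_transport smult_transport norm_transport

lemma banach_space_transport:
  assumes h: "inj h" and V: "banach_space V"
  shows "banach_space (transport h V)"
proof -
  interpret V: banach_space V by fact
  note [simp] = transport_simps[OF h] inj_eq[OF h]
  have normed: "normed_space (transport h V)"
  proof (intro normed_space.intro normed_space_axioms.intro)
    show "Module.module scalars (transport h V)"
      by (rule module_scalarsI) (auto simp: V.M.a_ac V.scale_add_left V.scale_add_right V.scale_scale)
  qed (auto simp: V.vnorm_nonneg V.vnorm_eq_0 V.vnorm_smult V.vnorm_triangle)
  then interpret W: normed_space "transport h V" .
  have diff: "h x \<ominus>\<^bsub>transport h V\<^esub> h y = h (x \<ominus>\<^bsub>V\<^esub> y)" if "x \<in> carrier V" "y \<in> carrier V" for x y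
    using that by (simp add: W.diff_scale V.diff_scale)
  show ?thesis
  proof (intro banach_space.intro banach_space_axioms.intro normed)
    fix s assume s: "s \<in> cauchy_seqs (transport h V)"
    define r where "r n = inv_into UNIV h (s n)" for n
    have r: "r n \<in> carrier V" "s n = h (r n)" for n
      using W.cauchy_seqs_closed[OF s, of n] h by (auto simp: r_def)
    have "r \<in> cauchy_seqs V"
      by (rule V.cauchy_seqsI) (use W.cauchy_seqsD[OF s] r in \<open>simp_all add: diff\<close>)
    then obtain a where "norm_conv V r a" using V.complete by blast
    then have "norm_conv (transport h V) s (h a)" using r by (auto simp: norm_conv_def diff)
    then show "\<exists>a. norm_conv (transport h V) s a" ..
  qed
qed

text \<open>\<open>S\<close> is the canonical tensor map and \<open>u\<close> the linearization of
  \<open>T\<close>, both moved to the copy \<open>G\<close>. A weakly null sequence in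
  \<open>G\<close> is weakly null in the tensor product, hence norm null by the Schur property, and
  a bounded operator keeps it norm null.\<close>

lemma multilinear_ops_subset_DP_comp_L:
  fixes E :: "'i::finite \<Rightarrow> ('k::real_normed_field, 'e) nspace"
    and h :: "('i, 'e, 'k) ptensor \<Rightarrow> 'g"
  assumes "\<And>i. banach_space (E i)" and F: "banach_space F"
    and schur: "schur_property (proj_tensor E)" and h: "inj h"
  shows "multilinear_ops E F \<subseteq> DP_comp_L TYPE('g) E F"
proof
  fix T assume T: "T \<in> multilinear_ops E F"
  interpret E: banach_space "E i" for i by fact
  interpret F: banach_space F by fact
  have E: "normed_space (E i)" for i by (rule E.normed_space_axioms)
  interpret P: banach_space "proj_tensor E" by (rule banach_space_proj_tensor[where E = E, OF E])
  define G where "G = transport h (proj_tensor E)"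
  have banach: "banach_space G" unfolding G_def by (rule banach_space_transport[OF h P.banach_space_axioms])
  then interpret G: banach_space G .
  note [simp] = transport_simps[OF h, of "proj_tensor E", folded G_def] inv_f_f[OF h] inj_eq[OF h]
  obtain w C where w: "w \<in> linear_ops (proj_tensor E) F"
    and C: "\<And>z. z \<in> carrier (proj_tensor E) \<Longrightarrow> vnorm F (w z) \<le> C * vnorm (proj_tensor E) z"
    and wT: "\<And>x. x \<in> tuples E \<Longrightarrow> w (pure_tensor E x) = T x"
    using proj_tensor_linearization[where E = E, OF E F T] by blast
  define S where "S = (\<lambda>x\<in>tuples E. h (pure_tensor E x))"
  \<comment> \<open>The inverse isometry from the copy to the tensor product, as a restricted map so
    that it belongs to \<open>linear_ops\<close>.\<close>
  define p where "p = (\<lambda>g\<in>carrier G. inv_into UNIV h g)"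
  define u where "u = (\<lambda>g\<in>carrier G. w (inv_into UNIV h g))"
  have "S \<in> multilinear_ops E G"
    unfolding multilinear_ops_iff[where E = E, OF E G.normed_space_axioms]
  proof
    show "multilinear E G S"
      unfolding multilinear_def
    proof (intro conjI ballI allI)
      show "S \<in> tuples E \<rightarrow>\<^sub>E carrier G" by (simp add: S_def pure_tensor_closed[where E = E, OF E])
      fix x i assume x: "x \<in> tuples E"
      show "(\<lambda>a\<in>carrier (E i). S (x(i := a))) \<in> linear_ops (E i) G"
        by (rule linear_opsI)
          (auto simp: S_def x tuples_upd pure_tensor_closed[where E = E, OF E] pure_tensor_add[where E = E, OF E x] pure_tensor_smult[where E = E, OF E x])
    qed
    show "\<exists>C. \<forall>x\<in>tuples E. vnorm G (S x) \<le> C * (\<Prod>i\<in>UNIV. vnorm (E i) (x i))"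
      by (rule exI[of _ 1]) (simp add: S_def norm_pure_tensor[where E = E, OF E])
  qed
  moreover have "u \<in> DP G F"
    unfolding DP_def
  proof (intro CollectI conjI allI impI)
    show "u \<in> linear_ops G F"
      by (rule linear_opsI) (auto simp: u_def linear_ops_closed[OF w] linear_ops_add[OF w] linear_ops_smult[OF w])
    show "\<exists>C. \<forall>x\<in>carrier G. vnorm F (u x) \<le> C * vnorm G x"
      by (rule exI[of _ C]) (auto simp: u_def C)
    fix s assume s: "weak_conv G s \<zero>\<^bsub>G\<^esub>"
    then have sG: "s n \<in> carrier G" for n by (auto simp: weak_conv_def)
    have p: "p \<in> linear_ops G (proj_tensor E)"
      by (rule linear_opsI) (auto simp: p_def)
    \<comment> \<open>The Schur property is assumed for the tensor product, not for its copy;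
      \<open>p\<close> is bounded with constant 1 and so transfers weak convergence.\<close>
    have "weak_conv (proj_tensor E) (\<lambda>n. p (s n)) (p \<zero>\<^bsub>G\<^esub>)"
      by (rule weak_conv_linear_image[OF G.normed_space_axioms P.normed_space_axioms p _ s, of 1])
        (auto simp: p_def)
    then have "norm_conv (proj_tensor E) (\<lambda>n. p (s n)) (p \<zero>\<^bsub>G\<^esub>)"
      using schur by (simp add: schur_property_def)
    from P.norm_conv_norm[OF this] have "(\<lambda>n. vnorm (proj_tensor E) (p (s n))) \<longlonglongrightarrow> 0"
      by (simp only: linear_ops_zero[OF G.seminormed_space P.seminormed_space p] P.seminorm_zero)
    note lim = tendsto_mult_right_zero[OF this, of C]
    show "(\<lambda>n. vnorm F (u (s n))) \<longlonglongrightarrow> 0"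
    proof (rule tendsto_sandwich[OF _ _ tendsto_const lim])
      have "0 \<le> vnorm F (u (s n)) \<and> vnorm F (u (s n)) \<le> C * vnorm (proj_tensor E) (p (s n))" for n
        using sG[of n] by (auto simp: u_def p_def C F.vnorm_nonneg linear_ops_closed[OF w])
      then show "\<forall>\<^sub>F n in sequentially. 0 \<le> vnorm F (u (s n))"
        "\<forall>\<^sub>F n in sequentially. vnorm F (u (s n)) \<le> C * vnorm (proj_tensor E) (p (s n))" by simp_all
    qed
  qed
  moreover have "T = compose (tuples E) u S"
  proof
    fix x
    have "T \<in> tuples E \<rightarrow>\<^sub>E carrier F" using T by (simp add: multilinear_ops_def)
    then show "T x = compose (tuples E) u S x"
      by (cases "x \<in> tuples E")
        (auto simp: compose_def S_def u_def wT pure_tensor_closed[where E = E, OF E] dest: PiE_arb)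
  qed
  ultimately show "T \<in> DP_comp_L TYPE('g) E F"
    unfolding DP_comp_L_def
    by (intro CollectI conjI T exI[of _ G] exI[of _ S] exI[of _ u] banach)
qed

theorem proposition3p20:
  fixes E :: "'i::finite \<Rightarrow> ('k::real_normed_field, 'e) nspace"
    and F :: "('k, 'f) nspace"
  assumes "\<And>i. banach_space (E i)"
    and "banach_space F"
    and "\<And>i. schur_property (E i)"
    and "schur_property (proj_tensor E)"
  shows "DP_comp_L TYPE(('i, 'e, 'k) ptensor + 'g) E F = L_WDP_ev E F"
proof -
  \<comment> \<open>The left summand holds the copy of the tensor product; the right one may be any
    type.\<close>
  have "inj (Inl :: ('i, 'e, 'k) ptensor \<Rightarrow> ('i, 'e, 'k) ptensor + 'g)" by simp
  from multilinear_ops_subset_DP_comp_L[where E = E, OF assms(1,2,4) this]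
  \<comment> \<open>Both classes are cut out of \<open>multilinear_ops\<close> by definition, so one
    inclusion for each makes both equal to it.\<close>
  have "DP_comp_L TYPE(('i, 'e, 'k) ptensor + 'g) E F = multilinear_ops E F"
    by (intro equalityI) (auto simp: DP_comp_L_def)
  moreover have "L_WDP_ev E F = multilinear_ops E F"
    using multilinear_ops_subset_L_WDP_ev[where E = E, OF assms(1-3)] by (intro equalityI) (auto simp: L_WDP_ev_def)
  ultimately show ?thesis by simp
qed

end
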